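(* Consider any network and any configuration of the system described in the context, in which the buffers, the variables $request_p$, and the routing tables may initially hold arbitrary values, and in which the routing algorithm $\mathcal{A}$ runs simultaneously with, and with priority over, the protocol $\mathcal{SSMFP}_1$. Then, under a weakly fair distributed daemon, every execution of $\mathcal{SSMFP}_1$ satisfies the specification $\mathcal{SP}$: (i) any processor that has a message to send generates it in finite time, and (ii) every valid message is delivered to its destination once and only once, in finite time. In other words, $\mathcal{SSMFP}_1$ is a snap-stabilizing message forwarding protocol for $\mathcal{SP}$, even if the routing tables are corrupted in the initial configuration.
   Context: Network and model. The network is a connected undirected graph $G=(V,E)$ with $n$ processors. Each processor has a unique identity, and every processor knows the set $I$ of all identities. $N_p$ denotes the set of neighbors of $p$, and $\Delta$ is the maximal degree. The system uses the local shared-memory (state) model. Each processor can read its own variables and those of its neighbors, and can write only its own variables. Its program is a finite set of rules of the form guard $\to$ statement. A configuration is the collection of the states of all processors. An execution is a maximal sequence of configurations. In each step, a distributed daemon chooses a nonempty subset of the enabled processors, and each chosen processor atomically executes one of its enabled rules. The daemon is weakly fair: every processor that is continuously enabled is eventually chosen. Routing. A self-stabilizing, silent algorithm $\mathcal{A}$ computes the routing tables. It runs simultaneously with the forwarding protocol and has priority over it: a processor that has enabled actions of both algorithms always executes an action of $\mathcal{A}$. Hence, from any initial state, in finite time the routing tables become correct (inducing minimal paths in number of edges) and constant. The function $nextHop_p(d)$ returns the neighbor of $p$ to which $p$ must currently forward messages of destination $d$. Higher layer. $request_p$ is a Boolean variable. The higher layer of $p$ may set it to true when it is false and a message is waiting;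 waiting is blocking. $nextMessage_p$ is the waiting message and $nextDestination_p$ is its destination (or null). $deliver_p(m)$ hands $m$ to the higher layer of $p$. Protocol $\mathcal{SSMFP}_1$. The following is run for every destination $d$. Each processor $p$ has two buffers $bufR_p(d)$ and $bufE_p(d)$. Each buffer is either empty ($\varepsilon$) or holds a triple $(m,q,c)$, where $m$ is the useful information, $q\in N_p\cup\{p\}$, and $c\in\{0,\dots,\Delta\}$. - $choice_p(d)$ fairly chooses (for example via a queue of length $\Delta+1$) a processor $s$ satisfying either - $s\in N_p$, $bufE_s(d)$ is nonempty, and $nextHop_s(d)=p$; or - $s=p$ and $request_p$ holds. - $color_p(d)$ returns some $c\in\{0,\dots,\Delta\}$ such that no $bufR_q(d)$ with $q\in N_p$ contains a message of color $c$. The rules are: - (R1) If $request_p$, $nextDestination_p=d$, $bufR_p(d)=\varepsilon$ and $choice_p(d)=p$: set $bufR_p(d):=(nextMessage_p,p,0)$ and $request_p:=false$. - (R2) If $bufE_p(d)=\varepsilon$, $bufR_p(d)=(m,q,c)$, and ($q=p$ or $bufE_q(d)\neq(m,q',c)$ for every $q'$): set $bufE_p(d):=(m,p,color_p(d))$ and $bufR_p(d):=\varepsilon$. - (R3) If $bufR_p(d)=\varepsilon$, $choice_p(d)=s\neq p$ and $bufE_s(d)=(m,q,c)$: set $bufR_p(d):=(m,s,c)$. - (R4) If $bufE_p(d)=(m,q,c)$, $p\neq d$, $bufR_{nextHop_p(d)}(d)=(m,p,c)$, and $bufR_r(d)\neq(m,p,c)$ for all $r\in N_p\setminus\{nextHop_p(d)\}$: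 set $bufE_p(d):=\varepsilon$. - (R5) If $bufR_p(d)=(m,q,c)$, $bufE_q(d)=(m,q',c)$ for some $q'$, and $nextHop_q(d)\neq p$: set $bufR_p(d):=\varepsilon$. - (R6) If $bufE_p(p)=(m,q,c)$: execute $deliver_p(m)$ and set $bufE_p(p):=\varepsilon$. Specification $\mathcal{SP}$. Any message can be generated in finite time, and any valid message is delivered to its destination once and only once in finite time. A valid message is one generated by a processor (by rule R1) during the execution. An invalid message is one present in the initial configuration. Two messages with the same useful information generated at different times are distinct messages. Snap-stabilizing for $\mathcal{SP}$ means that every execution, starting from an arbitrary configuration, satisfies $\mathcal{SP}$.
   Formalization: Corrections without which the claim fails: R5 applies only if q ≠ p; choice_p(d) may be p only if also nextDestination_p = d; nextHop_d(d) = d always, even in corrupted tables; weak fairness is also assumed for each processor within each destination's instance. *)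

theory Defs
  imports Main
begin

section \<open>Network\<close>

text \<open>The processors (equivalently, their identities) are the elements of a finite type;
  \<open>adj\<close> is the edge relation.\<close>

definition network :: "('v::finite \<Rightarrow> 'v \<Rightarrow> bool) \<Rightarrow> bool" where
  "network adj \<longleftrightarrow> symp adj \<and> irreflp adj \<and> (\<forall>p q. adj\<^sup>*\<^sup>* p q)"

definition nbrs :: "('v \<Rightarrow> 'v \<Rightarrow> bool) \<Rightarrow> 'v \<Rightarrow> 'v set" where
  "nbrs adj p = {q. adj p q}"

definition max_degree :: "('v::finite \<Rightarrow> 'v \<Rightarrow> bool) \<Rightarrow> nat" where
  "max_degree adj = Max (range (\<lambda>p. card (nbrs adj p)))"

definition hop_distance :: "('v \<Rightarrow> 'v \<Rightarrow> bool) \<Rightarrow> 'v \<Rightarrow> 'v \<Rightarrow> nat" where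
  "hop_distance adj p q = (LEAST k. (adj ^^ k) p q)"

section \<open>The routing algorithm\<close>

text \<open>\<open>moves A p \<sigma>\<close> is the set of local states that \<open>p\<close> can reach by executing one enabled rule
  of the routing algorithm when the local routing states are \<open>\<sigma>\<close>; it is empty iff \<open>p\<close> has no
  enabled rule. \<open>next_hop A p r d\<close> reads the routing table of \<open>p\<close> off its local state \<open>r\<close>.\<close>

record ('v, 'r) routing =
  moves :: "'v \<Rightarrow> ('v \<Rightarrow> 'r) \<Rightarrow> 'r set"
  next_hop :: "'v \<Rightarrow> 'r \<Rightarrow> 'v \<Rightarrow> 'v"

text \<open>The table of \<open>d\<close> has no entry for \<open>d\<close> itself, whatever its state: by convention the next
  hop is then \<open>d\<close>, so that no neighbour is ever designated to take a message away from its
  destination.\<close>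

definition routing_algorithm :: "('v \<Rightarrow> 'v \<Rightarrow> bool) \<Rightarrow> ('v, 'r) routing \<Rightarrow> bool" where
  "routing_algorithm adj A \<longleftrightarrow>
     (\<forall>p \<sigma> \<sigma>'. (\<forall>q \<in> insert p (nbrs adj p). \<sigma> q = \<sigma>' q) \<longrightarrow> moves A p \<sigma> = moves A p \<sigma>') \<and>
     (\<forall>p r d. p \<noteq> d \<longrightarrow> next_hop A p r d \<in> nbrs adj p) \<and>
     (\<forall>d r. next_hop A d r d = d)"

definition correct_tables ::
  "('v \<Rightarrow> 'v \<Rightarrow> bool) \<Rightarrow> ('v, 'r) routing \<Rightarrow> ('v \<Rightarrow> 'r) \<Rightarrow> bool" where
  "correct_tables adj A \<sigma> \<longleftrightarrow>
     (\<forall>p d. ((\<lambda>q. next_hop A q (\<sigma> q) d) ^^ hop_distance adj p d) p = d)"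

text \<open>Executions of the routing algorithm alone; \<open>S i\<close> is the set of processors chosen in step
  \<open>i\<close>. Throughout, a maximal finite execution is represented by repeating its last
  configuration.\<close>

definition routing_execution ::
  "('v, 'r) routing \<Rightarrow> (nat \<Rightarrow> 'v \<Rightarrow> 'r) \<Rightarrow> (nat \<Rightarrow> 'v set) \<Rightarrow> bool" where
  "routing_execution A \<sigma> S \<longleftrightarrow>
     (\<forall>i. (S i = {} \<longrightarrow> (\<forall>p. moves A p (\<sigma> i) = {})) \<and>
          (\<forall>p \<in> S i. \<sigma> (Suc i) p \<in> moves A p (\<sigma> i)) \<and>
          (\<forall>p. p \<notin> S i \<longrightarrow> \<sigma> (Suc i) p = \<sigma> i p))"

definition routing_weakly_fair ::
  "('v, 'r) routing \<Rightarrow> (nat \<Rightarrow> 'v \<Rightarrow> 'r) \<Rightarrow> (nat \<Rightarrow> 'v set) \<Rightarrow> bool" where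
  "routing_weakly_fair A \<sigma> S \<longleftrightarrow>
     (\<forall>p i. (\<forall>j\<ge>i. moves A p (\<sigma> j) \<noteq> {}) \<longrightarrow> (\<exists>j\<ge>i. p \<in> S j))"

definition silent_self_stabilizing ::
  "('v \<Rightarrow> 'v \<Rightarrow> bool) \<Rightarrow> ('v, 'r) routing \<Rightarrow> bool" where
  "silent_self_stabilizing adj A \<longleftrightarrow>
     (\<forall>\<sigma> S. routing_execution A \<sigma> S \<and> routing_weakly_fair A \<sigma> S \<longrightarrow>
        (\<exists>k. (\<forall>p. moves A p (\<sigma> k) = {}) \<and> correct_tables adj A (\<sigma> k)))"

section \<open>Configurations\<close>

text \<open>\<open>Msg m q c g\<close> is the triple \<open>(m, q, c)\<close> together with a ghost identity \<open>g\<close>, which no guard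
  inspects. It is \<open>Generated t p\<close> for the (valid) message generated by \<open>p\<close> in step \<open>t\<close> and for
  all its copies, and \<open>Initial\<close> for the (invalid) messages of the initial configuration. A
  processor executes at most one rule per step, so distinct generated messages have distinct
  identities.\<close>

datatype 'v ident = Initial | Generated nat 'v

datatype ('v, 'm) message = Msg (info: 'm) (sender: 'v) (color: nat) (ident: "'v ident")

text \<open>\<open>waiting\<close> is \<open>Some (nextMessage, nextDestination)\<close>, or \<open>None\<close> if the destination is null.\<close>

record ('v, 'm, 'r) pstate =
  bufR :: "'v \<Rightarrow> ('v, 'm) message option"
  bufE :: "'v \<Rightarrow> ('v, 'm) message option"
  request :: bool
  waiting :: "('m \<times> 'v) option"
  table :: 'r

type_synonym ('v, 'm, 'r) config = "'v \<Rightarrow> ('v, 'm, 'r) pstate"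

definition hop :: "('v, 'r) routing \<Rightarrow> ('v, 'm, 'r) config \<Rightarrow> 'v \<Rightarrow> 'v \<Rightarrow> 'v" where
  "hop A C p d = next_hop A p (table (C p)) d"

definition routing_enabled :: "('v, 'r) routing \<Rightarrow> ('v, 'm, 'r) config \<Rightarrow> 'v \<Rightarrow> bool" where
  "routing_enabled A C p \<longleftrightarrow> moves A p (\<lambda>q. table (C q)) \<noteq> {}"

definition initial_configuration ::
  "('v::finite \<Rightarrow> 'v \<Rightarrow> bool) \<Rightarrow> ('v, 'm, 'r) config \<Rightarrow> bool" where
  "initial_configuration adj C \<longleftrightarrow>
     (\<forall>p d x. bufR (C p) d = Some x \<or> bufE (C p) d = Some x \<longrightarrow>
        sender x \<in> insert p (nbrs adj p) \<and> color x \<le> max_degree adj \<and> ident x = Initial)"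

section \<open>The forwarding protocol\<close>

definition holds_msg :: "('v, 'm) message option \<Rightarrow> 'm \<Rightarrow> 'v \<Rightarrow> nat \<Rightarrow> bool" where
  "holds_msg b m q c \<longleftrightarrow> (\<exists>g. b = Some (Msg m q c g))"

text \<open>The processors among which \<open>choice\<^sub>p(d)\<close> selects. The request of \<open>p\<close> competes for
  \<open>bufR\<^sub>p(d)\<close> only if it is for destination \<open>d\<close>: otherwise \<open>choice\<^sub>p(d) = p\<close> would disable both
  R1 and R3 for \<open>d\<close>, and requests of neighbours for each other's identity could deadlock.\<close>

definition candidate ::
  "('v \<Rightarrow> 'v \<Rightarrow> bool) \<Rightarrow> ('v, 'r) routing \<Rightarrow> ('v, 'm, 'r) config \<Rightarrow> 'v \<Rightarrow> 'v \<Rightarrow> 'v \<Rightarrow> bool" where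
  "candidate adj A C p d s \<longleftrightarrow>
     (s \<in> nbrs adj p \<and> bufE (C s) d \<noteq> None \<and> hop A C s d = p) \<or>
     (s = p \<and> request (C p) \<and> (\<exists>m. waiting (C p) = Some (m, d)))"

text \<open>The possible values of \<open>color\<^sub>p(d)\<close>.\<close>

definition free_colors ::
  "('v::finite \<Rightarrow> 'v \<Rightarrow> bool) \<Rightarrow> ('v, 'm, 'r) config \<Rightarrow> 'v \<Rightarrow> 'v \<Rightarrow> nat set" where
  "free_colors adj C p d =
     {c. c \<le> max_degree adj \<and> (\<forall>q \<in> nbrs adj p. \<forall>x. bufR (C q) d = Some x \<longrightarrow> color x \<noteq> c)}"

datatype rule = R1 | R2 | R3 | R4 | R5 | R6

text \<open>\<open>forward_move adj A t C ch p d \<rho> s\<close>: in configuration \<open>C\<close> of step \<open>t\<close>, with \<open>ch p d\<close> the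
  value of \<open>choice\<^sub>p(d)\<close>, rule \<open>\<rho>\<close> of processor \<open>p\<close> for destination \<open>d\<close> is enabled and its
  execution may lead \<open>p\<close> to the local state \<open>s\<close>. R5 removes copies received from a neighbour;
  without \<open>q \<noteq> p\<close> it would also remove a message just generated by \<open>p\<close> when \<open>bufE\<^sub>p(d)\<close> holds
  another message with the same useful information and color 0.\<close>

inductive forward_move ::
  "('v::finite \<Rightarrow> 'v \<Rightarrow> bool) \<Rightarrow> ('v, 'r) routing \<Rightarrow> nat \<Rightarrow> ('v, 'm, 'r) config \<Rightarrow>
   ('v \<Rightarrow> 'v \<Rightarrow> 'v option) \<Rightarrow> 'v \<Rightarrow> 'v \<Rightarrow> rule \<Rightarrow> ('v, 'm, 'r) pstate \<Rightarrow> bool"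
  for adj A t C ch where
  R1: "\<lbrakk>request (C p); waiting (C p) = Some (m, d); bufR (C p) d = None; ch p d = Some p\<rbrakk> \<Longrightarrow>
    forward_move adj A t C ch p d R1
      ((C p)\<lparr>bufR := (bufR (C p))(d := Some (Msg m p 0 (Generated t p))),
             request := False, waiting := None\<rparr>)"
| R2: "\<lbrakk>bufE (C p) d = None; bufR (C p) d = Some (Msg m q c g);
        q = p \<or> (\<forall>q'. \<not> holds_msg (bufE (C q) d) m q' c); c' \<in> free_colors adj C p d\<rbrakk> \<Longrightarrow>
    forward_move adj A t C ch p d R2
      ((C p)\<lparr>bufE := (bufE (C p))(d := Some (Msg m p c' g)), bufR := (bufR (C p))(d := None)\<rparr>)"
| R3: "\<lbrakk>bufR (C p) d = None; ch p d = Some s; s \<noteq> p; bufE (C s) d = Some (Msg m q c g)\<rbrakk> \<Longrightarrow>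
    forward_move adj A t C ch p d R3
      ((C p)\<lparr>bufR := (bufR (C p))(d := Some (Msg m s c g))\<rparr>)"
| R4: "\<lbrakk>bufE (C p) d = Some (Msg m q c g); p \<noteq> d; holds_msg (bufR (C (hop A C p d)) d) m p c;
        \<forall>r \<in> nbrs adj p - {hop A C p d}. \<not> holds_msg (bufR (C r) d) m p c\<rbrakk> \<Longrightarrow>
    forward_move adj A t C ch p d R4
      ((C p)\<lparr>bufE := (bufE (C p))(d := None)\<rparr>)"
| R5: "\<lbrakk>bufR (C p) d = Some (Msg m q c g); q \<noteq> p; holds_msg (bufE (C q) d) m q' c;
        hop A C q d \<noteq> p\<rbrakk> \<Longrightarrow>
    forward_move adj A t C ch p d R5
      ((C p)\<lparr>bufR := (bufR (C p))(d := None)\<rparr>)"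
| R6: "bufE (C p) p = Some (Msg m q c g) \<Longrightarrow>
    forward_move adj A t C ch p p R6
      ((C p)\<lparr>bufE := (bufE (C p))(p := None)\<rparr>)"

text \<open>The routing algorithm has priority.\<close>

definition instance_enabled ::
  "('v::finite \<Rightarrow> 'v \<Rightarrow> bool) \<Rightarrow> ('v, 'r) routing \<Rightarrow> nat \<Rightarrow> ('v, 'm, 'r) config \<Rightarrow>
   ('v \<Rightarrow> 'v \<Rightarrow> 'v option) \<Rightarrow> 'v \<Rightarrow> 'v \<Rightarrow> bool" where
  "instance_enabled adj A t C ch p d \<longleftrightarrow>
     \<not> routing_enabled A C p \<and> (\<exists>\<rho> s. forward_move adj A t C ch p d \<rho> s)"

definition enabled ::
  "('v::finite \<Rightarrow> 'v \<Rightarrow> bool) \<Rightarrow> ('v, 'r) routing \<Rightarrow> nat \<Rightarrow> ('v, 'm, 'r) config \<Rightarrow>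
   ('v \<Rightarrow> 'v \<Rightarrow> 'v option) \<Rightarrow> 'v \<Rightarrow> bool" where
  "enabled adj A t C ch p \<longleftrightarrow>
     routing_enabled A C p \<or> (\<exists>d. instance_enabled adj A t C ch p d)"

section \<open>Executions\<close>

datatype 'v action = Route | Forward 'v rule

text \<open>What the chosen processor \<open>p\<close> may do in step \<open>t\<close>; \<open>None\<close> means that \<open>p\<close> is not chosen.\<close>

fun local_step ::
  "('v::finite \<Rightarrow> 'v \<Rightarrow> bool) \<Rightarrow> ('v, 'r) routing \<Rightarrow> nat \<Rightarrow> ('v, 'm, 'r) config \<Rightarrow>
   ('v \<Rightarrow> 'v \<Rightarrow> 'v option) \<Rightarrow> 'v \<Rightarrow> 'v action option \<Rightarrow> ('v, 'm, 'r) pstate \<Rightarrow> bool" where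
  "local_step adj A t C ch p None s \<longleftrightarrow> s = C p"
| "local_step adj A t C ch p (Some Route) s \<longleftrightarrow>
     (\<exists>r \<in> moves A p (\<lambda>q. table (C q)). s = (C p)\<lparr>table := r\<rparr>)"
| "local_step adj A t C ch p (Some (Forward d \<rho>)) s \<longleftrightarrow>
     \<not> routing_enabled A C p \<and> forward_move adj A t C ch p d \<rho> s"

text \<open>The higher layer may produce a message when none is waiting, and may raise \<open>request\<close> when a
  message is waiting; a waiting message and a raised request stay until R1 is executed.\<close>

definition higher_layer :: "('v, 'm, 'r) pstate \<Rightarrow> ('v, 'm, 'r) pstate \<Rightarrow> bool" where
  "higher_layer s s' \<longleftrightarrow>
     (\<exists>b w. s' = s\<lparr>request := b, waiting := w\<rparr> \<and>
        (waiting s \<noteq> None \<longrightarrow> w = waiting s) \<and>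
        (request s \<longrightarrow> b) \<and>
        (b \<and> \<not> request s \<longrightarrow> w \<noteq> None))"

text \<open>\<open>act i p\<close> is the action of \<open>p\<close> in step \<open>i\<close> and \<open>ch i p d\<close> the value of \<open>choice\<^sub>p(d)\<close> in
  configuration \<open>i\<close>. The actions of the higher layers between two steps of the daemon are
  attached to the first of them; those before the first step are covered by the arbitrary
  initial configuration.\<close>

definition execution ::
  "('v::finite \<Rightarrow> 'v \<Rightarrow> bool) \<Rightarrow> ('v, 'r) routing \<Rightarrow> (nat \<Rightarrow> ('v, 'm, 'r) config) \<Rightarrow>
   (nat \<Rightarrow> 'v \<Rightarrow> 'v action option) \<Rightarrow> (nat \<Rightarrow> 'v \<Rightarrow> 'v \<Rightarrow> 'v option) \<Rightarrow> bool" where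
  "execution adj A cfg act ch \<longleftrightarrow>
     (\<forall>i. ((\<forall>p. act i p = None) \<longrightarrow> (\<forall>p. \<not> enabled adj A i (cfg i) (ch i) p)) \<and>
          (\<forall>p. \<exists>s. local_step adj A i (cfg i) (ch i) p (act i p) s \<and>
                    higher_layer s (cfg (Suc i) p)))"

text \<open>\<open>choice\<^sub>p(d)\<close> designates a candidate whenever there is one, and a permanent candidate is not
  passed over forever by the executions of R1 and R3.\<close>

definition fair_choice ::
  "('v \<Rightarrow> 'v \<Rightarrow> bool) \<Rightarrow> ('v, 'r) routing \<Rightarrow> (nat \<Rightarrow> ('v, 'm, 'r) config) \<Rightarrow>
   (nat \<Rightarrow> 'v \<Rightarrow> 'v action option) \<Rightarrow> (nat \<Rightarrow> 'v \<Rightarrow> 'v \<Rightarrow> 'v option) \<Rightarrow> bool" where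
  "fair_choice adj A cfg act ch \<longleftrightarrow>
     (\<forall>i p d s. ch i p d = Some s \<longrightarrow> candidate adj A (cfg i) p d s) \<and>
     (\<forall>i p d. (\<exists>s. candidate adj A (cfg i) p d s) \<longrightarrow> ch i p d \<noteq> None) \<and>
     (\<forall>p d s i.
        (\<forall>j\<ge>i. candidate adj A (cfg j) p d s) \<and>
        (\<forall>k. \<exists>j\<ge>k. act j p \<in> {Some (Forward d R1), Some (Forward d R3)}) \<longrightarrow>
        (\<exists>j\<ge>i. act j p \<in> {Some (Forward d R1), Some (Forward d R3)} \<and> ch j p d = Some s))"

text \<open>The protocol is run for every destination; weak fairness holds for the processors and, for
  each destination, for the processors in the corresponding instance of the protocol. Without
  the latter, a processor could forever serve a single destination.\<close>

definition weakly_fair ::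
  "('v::finite \<Rightarrow> 'v \<Rightarrow> bool) \<Rightarrow> ('v, 'r) routing \<Rightarrow> (nat \<Rightarrow> ('v, 'm, 'r) config) \<Rightarrow>
   (nat \<Rightarrow> 'v \<Rightarrow> 'v action option) \<Rightarrow> (nat \<Rightarrow> 'v \<Rightarrow> 'v \<Rightarrow> 'v option) \<Rightarrow> bool" where
  "weakly_fair adj A cfg act ch \<longleftrightarrow>
     (\<forall>p i. (\<forall>j\<ge>i. enabled adj A j (cfg j) (ch j) p) \<longrightarrow> (\<exists>j\<ge>i. act j p \<noteq> None)) \<and>
     (\<forall>p d i. (\<forall>j\<ge>i. instance_enabled adj A j (cfg j) (ch j) p d) \<longrightarrow>
        (\<exists>j\<ge>i. \<exists>\<rho>. act j p = Some (Forward d \<rho>)))"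

section \<open>Specification\<close>

definition generates ::
  "(nat \<Rightarrow> ('v, 'm, 'r) config) \<Rightarrow> (nat \<Rightarrow> 'v \<Rightarrow> 'v action option) \<Rightarrow> nat \<Rightarrow> 'v \<Rightarrow> 'm \<Rightarrow> 'v \<Rightarrow> bool" where
  "generates cfg act i p m d \<longleftrightarrow>
     act i p = Some (Forward d R1) \<and> waiting (cfg i p) = Some (m, d)"

definition delivers ::
  "(nat \<Rightarrow> ('v, 'm, 'r) config) \<Rightarrow> (nat \<Rightarrow> 'v \<Rightarrow> 'v action option) \<Rightarrow> nat \<Rightarrow> 'v \<Rightarrow> 'm \<Rightarrow> 'v ident \<Rightarrow> bool" where
  "delivers cfg act j q m g \<longleftrightarrow>
     act j q = Some (Forward q R6) \<and> (\<exists>q' c. bufE (cfg j q) q = Some (Msg m q' c g))"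

text \<open>The higher layer is not obliged to raise \<open>request\<close>; the message waiting at \<open>i\<close> is generated
  provided that the request is, or later becomes, raised.\<close>

definition generation_in_finite_time ::
  "(nat \<Rightarrow> ('v, 'm, 'r) config) \<Rightarrow> (nat \<Rightarrow> 'v \<Rightarrow> 'v action option) \<Rightarrow> bool" where
  "generation_in_finite_time cfg act \<longleftrightarrow>
     (\<forall>i p m d. waiting (cfg i p) = Some (m, d) \<and> (\<exists>k\<ge>i. request (cfg k p)) \<longrightarrow>
        (\<exists>j\<ge>i. generates cfg act j p m d))"

definition delivery_exactly_once ::
  "(nat \<Rightarrow> ('v, 'm, 'r) config) \<Rightarrow> (nat \<Rightarrow> 'v \<Rightarrow> 'v action option) \<Rightarrow> bool" where
  "delivery_exactly_once cfg act \<longleftrightarrow>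
     (\<forall>i p m d. generates cfg act i p m d \<longrightarrow>
        (\<exists>j>i. {(j', q, m'). delivers cfg act j' q m' (Generated i p)} = {(j, d, m)}))"

definition specification_SP ::
  "(nat \<Rightarrow> ('v, 'm, 'r) config) \<Rightarrow> (nat \<Rightarrow> 'v \<Rightarrow> 'v action option) \<Rightarrow> bool" where
  "specification_SP cfg act \<longleftrightarrow> generation_in_finite_time cfg act \<and> delivery_exactly_once cfg act"

end

theory Submission
  imports Defs "HOL-Library.Infinite_Set"
begin

text \<open>Safety does not depend on the routing tables. Since R2 takes a color that no neighbour holds
  in \<open>bufR\<close>, a neighbour whose \<open>bufR\<close> matches the color of \<open>bufE\<^sub>p\<close> with sender \<open>p\<close> has copied the
  message from there. Hence R4 and R5 never erase the last copy of a valid message, and a valid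
  message sits in at most one \<open>bufE\<close>, which is its only copy when R6 delivers it.

  For liveness, the routing tables are correct and constant from some time on. Then for each
  destination \<open>d\<close>, by induction along the route to \<open>d\<close>, no message stays forever in a buffer:
  \<open>bufE\<^sub>d\<close> is emptied by R6; if \<open>bufE\<^sub>p\<close> always drains then so does \<open>bufR\<^sub>p\<close>; and if \<open>bufR\<close> of the
  next hop of \<open>p\<close> always drains then, by fairness of the choice, it receives the message of
  \<open>bufE\<^sub>p\<close>, and it can only drain again after \<open>bufE\<^sub>p\<close> has been emptied. Fairness of the choice
  likewise lets every request through.\<close>

section \<open>Stabilization of the routing tables\<close>

text \<open>Turns a content that differs at some later time into a concrete step at which it is
  lost, to which the analysis of the rules applies.\<close>

lemma eventually_leaves:
  fixes i :: nat
  assumes "P i" "j \<ge> i" "\<not> P j"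
  shows "\<exists>k\<ge>i. P k \<and> \<not> P (Suc k)"
  using assms(2,1,3)
  by (induction rule: dec_induct) auto

lemma constant_without_changes:
  fixes f :: "nat \<Rightarrow> 'a"
  assumes "a \<le> b" "\<And>j. a \<le> j \<Longrightarrow> j < b \<Longrightarrow> f (Suc j) = f j"
  shows "f b = f a"
  using assms by (induction rule: dec_induct) auto

text \<open>In an execution of both algorithms a step need not contain any action of the routing
  algorithm. Deleting these stuttering steps leaves an execution of the routing algorithm alone.\<close>

lemma stuttering_routing_stabilizes:
  assumes stab: "silent_self_stabilizing adj A"
    and move: "\<And>i p. p \<in> S i \<Longrightarrow> \<sigma> (Suc i) p \<in> moves A p (\<sigma> i)"
    and idle: "\<And>i p. p \<notin> S i \<Longrightarrow> \<sigma> (Suc i) p = \<sigma> i p"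
    and fair: "\<And>i p. (\<And>j. j \<ge> i \<Longrightarrow> moves A p (\<sigma> j) \<noteq> {}) \<Longrightarrow> \<exists>j\<ge>i. p \<in> S j"
  shows "\<exists>k. (\<forall>p. moves A p (\<sigma> k) = {}) \<and> correct_tables adj A (\<sigma> k)"
proof -
  have const: "\<sigma> b = \<sigma> a" if "a \<le> b" "\<And>j. a \<le> j \<Longrightarrow> j < b \<Longrightarrow> S j = {}" for a b
    using that(1) by (rule constant_without_changes) (use that(2) idle in \<open>auto simp: fun_eq_iff\<close>)
  let ?I = "{j. S j \<noteq> {}}"
  show ?thesis
  proof (cases "finite ?I")
    case True
    then obtain i where "\<forall>j\<in>?I. j < i"
      unfolding finite_nat_set_iff_bounded by blast
    then have i: "S j = {}" if "j \<ge> i" for j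
      using that by (auto simp: not_less[symmetric])
    have eq: "\<sigma> j = \<sigma> i" if "j \<ge> i" for j
      using const[OF that] i by simp
    have "moves A p (\<sigma> i) = {}" for p
    proof (rule ccontr)
      assume "moves A p (\<sigma> i) \<noteq> {}"
      then have "moves A p (\<sigma> j) \<noteq> {}" if "j \<ge> i" for j
        using eq[OF that] by simp
      then have "\<exists>j\<ge>i. p \<in> S j" by (rule fair)
      then show False using i by auto
    qed
    \<comment> \<open>Fairness leaves no processor enabled at \<open>i\<close>, so the constant
      sequence with nobody chosen is a finite maximal execution in its repeated form.\<close>
    then have "routing_execution A (\<lambda>_. \<sigma> i) (\<lambda>_. {})" "routing_weakly_fair A (\<lambda>_. \<sigma> i) (\<lambda>_. {})"
      by (auto simp: routing_execution_def routing_weakly_fair_def)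
    then show ?thesis
      using stab unfolding silent_self_stabilizing_def by blast
  next
    case False
    \<comment> \<open>\<open>e\<close> lists in increasing order the steps in which the routing
      algorithm acts; the states are constant in between.\<close>
    define e where "e = enumerate ?I"
    have ne: "S (e k) \<noteq> {}" for k
      using enumerate_in_set[OF False, of k] by (simp add: e_def)
    have e_Suc: "e (Suc k) = (LEAST s. S s \<noteq> {} \<and> e k < s)" for k
      unfolding e_def using enumerate_Suc''[OF False, of k] by simp
    have gap: "S j = {}" if "Suc (e k) \<le> j" "j < e (Suc k)" for j k
      using that not_less_Least[of j "\<lambda>s. S s \<noteq> {} \<and> e k < s"] by (auto simp: e_Suc)
    have mono: "strict_mono e"
      unfolding e_def using strict_mono_enumerate[OF False] .
    have eS: "\<sigma> (e (Suc k)) = \<sigma> (Suc (e k))" for k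
      using strict_monoD[OF mono, of k "Suc k"] gap by (intro const) auto
    have "routing_execution A (\<lambda>k. \<sigma> (e k)) (\<lambda>k. S (e k))"
      unfolding routing_execution_def eS using ne move idle by auto
    moreover have "routing_weakly_fair A (\<lambda>k. \<sigma> (e k)) (\<lambda>k. S (e k))"
      unfolding routing_weakly_fair_def
    proof (intro allI impI)
      fix p k assume k: "\<forall>j\<ge>k. moves A p (\<sigma> (e j)) \<noteq> {}"
      \<comment> \<open>Fairness is given only for the full sequence, so enabledness has to be
        carried to the deleted steps: the states at \<open>j\<close> are those at the next listed
        step, whose index is at least \<open>k\<close>.\<close>
      have "moves A p (\<sigma> j) \<noteq> {}" if "j \<ge> e k" for j
      proof -
        let ?n = "LEAST n. n \<ge> j \<and> S n \<noteq> {}"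
        have "\<exists>n. n \<ge> j \<and> S n \<noteq> {}"
          using False unfolding infinite_nat_iff_unbounded_le by auto
        then have n: "?n \<ge> j" "S ?n \<noteq> {}"
          using LeastI_ex[of "\<lambda>n. n \<ge> j \<and> S n \<noteq> {}"] by auto
        have "S i = {}" if "j \<le> i" "i < ?n" for i
          using not_less_Least[OF that(2)] that(1) by auto
        then have "\<sigma> ?n = \<sigma> j" by (intro const n)
        moreover obtain k' where k': "e k' = ?n"
          using enumerate_Ex[OF False] n(2) unfolding e_def by blast
        moreover have "k' \<ge> k"
          using k' n(1) that mono by (metis le_trans strict_mono_less_eq)
        ultimately show ?thesis using k by metis
      qed
      then obtain j where j: "j \<ge> e k" "p \<in> S j" using fair by blast
      then obtain k' where k': "e k' = j"
        using enumerate_Ex[OF False] unfolding e_def by blast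
      then have "k' \<ge> k"
        using j(1) mono by (metis strict_mono_less_eq)
      then show "\<exists>j\<ge>k. p \<in> S (e j)" using k' j(2) by blast
    qed
    ultimately show ?thesis
      using stab unfolding silent_self_stabilizing_def by blast
  qed
qed

section \<open>Steps of an execution\<close>

locale ssmfp_execution =
  fixes adj :: "'v::finite \<Rightarrow> 'v \<Rightarrow> bool"
    and A :: "('v, 'r) routing"
    and cfg :: "nat \<Rightarrow> ('v, 'm, 'r) config"
    and act :: "nat \<Rightarrow> 'v \<Rightarrow> 'v action option"
    and ch :: "nat \<Rightarrow> 'v \<Rightarrow> 'v \<Rightarrow> 'v option"
  assumes network: "network adj"
    and routing: "routing_algorithm adj A"
    and stabilizing: "silent_self_stabilizing adj A"
    and initial: "initial_configuration adj (cfg 0)"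
    and execution: "execution adj A cfg act ch"
    and fair_choice: "fair_choice adj A cfg act ch"
    and weakly_fair: "weakly_fair adj A cfg act ch"
begin

abbreviation R :: "nat \<Rightarrow> 'v \<Rightarrow> 'v \<Rightarrow> ('v, 'm) message option" where
  "R i p d \<equiv> bufR (cfg i p) d"

abbreviation E :: "nat \<Rightarrow> 'v \<Rightarrow> 'v \<Rightarrow> ('v, 'm) message option" where
  "E i p d \<equiv> bufE (cfg i p) d"

lemma nbrs_sym: "q \<in> nbrs adj p \<longleftrightarrow> p \<in> nbrs adj q"
  using network by (auto simp: network_def nbrs_def symp_def)

lemma nbrs_irrefl: "p \<notin> nbrs adj p"
  using network by (auto simp: network_def nbrs_def irreflp_def)

lemma hop_self: "hop A C d d = d"
  using routing by (auto simp: routing_algorithm_def hop_def)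

lemma hop_nbr: "p \<noteq> d \<Longrightarrow> hop A C p d \<in> nbrs adj p"
  using routing by (auto simp: routing_algorithm_def hop_def)

lemma step: "\<exists>s. local_step adj A i (cfg i) (ch i) p (act i p) s \<and> higher_layer s (cfg (Suc i) p)"
  using execution unfolding execution_def by blast

lemma higher_layer_buffers:
  assumes "higher_layer s s'"
  shows "bufR s' = bufR s" "bufE s' = bufE s" "table s' = table s"
  using assms by (auto simp: higher_layer_def)

text \<open>The higher layer acts after the rule but touches neither buffers nor tables, so these
  can be read off the state produced by the rule.\<close>

lemma forward_step:
  assumes "act i p = Some (Forward d \<rho>)"
  obtains s where "\<not> routing_enabled A (cfg i) p" "forward_move adj A i (cfg i) (ch i) p d \<rho> s"
    "bufR (cfg (Suc i) p) = bufR s" "bufE (cfg (Suc i) p) = bufE s"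
    "table (cfg (Suc i) p) = table s" "higher_layer s (cfg (Suc i) p)"
proof -
  obtain s where "\<not> routing_enabled A (cfg i) p" "forward_move adj A i (cfg i) (ch i) p d \<rho> s"
    "higher_layer s (cfg (Suc i) p)"
    using step[of i p] assms by auto
  then show thesis using that[of s] higher_layer_buffers[of s] by blast
qed

section \<open>Effect of the single rules on the buffers\<close>

lemma R1_step:
  assumes "act i p = Some (Forward d R1)"
  obtains m where "request (cfg i p)" "waiting (cfg i p) = Some (m, d)" "R i p d = None"
    "ch i p d = Some p" "R (Suc i) p d = Some (Msg m p 0 (Generated i p))"
    "E (Suc i) p d = E i p d"
  using assms
proof (rule forward_step)
  fix s assume "forward_move adj A i (cfg i) (ch i) p d R1 s"
    and "bufR (cfg (Suc i) p) = bufR s" "bufE (cfg (Suc i) p) = bufE s"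
  then show thesis by cases (rule that; simp)
qed

lemma R2_step:
  assumes "act i p = Some (Forward d R2)"
  obtains m q c g c' where "E i p d = None" "R i p d = Some (Msg m q c g)"
    "q = p \<or> (\<forall>q'. \<not> holds_msg (E i q d) m q' c)" "c' \<in> free_colors adj (cfg i) p d"
    "E (Suc i) p d = Some (Msg m p c' g)" "R (Suc i) p d = None"
  using assms
proof (rule forward_step)
  fix s assume "forward_move adj A i (cfg i) (ch i) p d R2 s"
    and "bufR (cfg (Suc i) p) = bufR s" "bufE (cfg (Suc i) p) = bufE s"
  then show thesis by cases (rule that; simp)
qed

lemma choice_candidate: "ch i p d = Some s \<Longrightarrow> candidate adj A (cfg i) p d s"
  using fair_choice by (simp add: fair_choice_def)

lemma candidate_nbr:
  assumes "ch i p d = Some s" "s \<noteq> p"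
  shows "s \<in> nbrs adj p" "E i s d \<noteq> None" "hop A (cfg i) s d = p"
  using choice_candidate[OF assms(1)] assms(2) by (simp_all add: candidate_def)

lemma R3_step:
  assumes "act i p = Some (Forward d R3)"
  obtains m s q c g where "R i p d = None" "ch i p d = Some s" "s \<noteq> p" "s \<in> nbrs adj p"
    "hop A (cfg i) s d = p" "E i s d = Some (Msg m q c g)"
    "R (Suc i) p d = Some (Msg m s c g)" "E (Suc i) p d = E i p d"
proof -
  obtain m s q c g where "R i p d = None" "ch i p d = Some s" "s \<noteq> p"
    "E i s d = Some (Msg m q c g)" "R (Suc i) p d = Some (Msg m s c g)" "E (Suc i) p d = E i p d"
    using assms
  proof (rule forward_step)
    fix s assume "forward_move adj A i (cfg i) (ch i) p d R3 s"
      and "bufR (cfg (Suc i) p) = bufR s" "bufE (cfg (Suc i) p) = bufE s"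
    then show ?thesis by cases (rule that; simp)
  qed
  then show thesis using that candidate_nbr by blast
qed

lemma R4_step:
  assumes "act i p = Some (Forward d R4)"
  obtains m q c g where "E i p d = Some (Msg m q c g)" "p \<noteq> d"
    "holds_msg (R i (hop A (cfg i) p d) d) m p c"
    "\<And>r. r \<in> nbrs adj p \<Longrightarrow> r \<noteq> hop A (cfg i) p d \<Longrightarrow> \<not> holds_msg (R i r d) m p c"
    "E (Suc i) p d = None" "R (Suc i) p d = R i p d"
  using assms
proof (rule forward_step)
  fix s assume "forward_move adj A i (cfg i) (ch i) p d R4 s"
    and "bufR (cfg (Suc i) p) = bufR s" "bufE (cfg (Suc i) p) = bufE s"
  then show thesis by cases (rule that; auto)
qed

lemma R5_step:
  assumes "act i p = Some (Forward d R5)"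
  obtains m q c g q' where "R i p d = Some (Msg m q c g)" "q \<noteq> p" "holds_msg (E i q d) m q' c"
    "hop A (cfg i) q d \<noteq> p" "R (Suc i) p d = None" "E (Suc i) p d = E i p d"
  using assms
proof (rule forward_step)
  fix s assume "forward_move adj A i (cfg i) (ch i) p d R5 s"
    and "bufR (cfg (Suc i) p) = bufR s" "bufE (cfg (Suc i) p) = bufE s"
  then show thesis by cases (rule that; simp)
qed

lemma R6_step:
  assumes "act i p = Some (Forward d R6)"
  obtains m q c g where "p = d" "E i p d = Some (Msg m q c g)" "E (Suc i) p d = None"
    "R (Suc i) p d = R i p d"
  using assms
proof (rule forward_step)
  fix s assume "forward_move adj A i (cfg i) (ch i) p d R6 s"
    and "bufR (cfg (Suc i) p) = bufR s" "bufE (cfg (Suc i) p) = bufE s"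
  then show thesis by cases (rule that; simp)
qed

text \<open>Rules for other destinations write other buffers, and routing actions and the higher
  layer write none; each destination can thus be treated separately.\<close>

lemma no_step:
  assumes "\<And>\<rho>. act i p \<noteq> Some (Forward d \<rho>)"
  shows "R (Suc i) p d = R i p d" "E (Suc i) p d = E i p d"
proof -
  consider "act i p = None" | "act i p = Some Route"
    | d' \<rho> where "act i p = Some (Forward d' \<rho>)" "d' \<noteq> d"
    using assms by (metis action.exhaust not_None_eq)
  then have "R (Suc i) p d = R i p d \<and> E (Suc i) p d = E i p d"
  proof cases
    case 3
    show ?thesis
      using 3(1)
    proof (rule forward_step)
      fix s assume "forward_move adj A i (cfg i) (ch i) p d' \<rho> s"
        and "bufR (cfg (Suc i) p) = bufR s" "bufE (cfg (Suc i) p) = bufE s"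
      then show ?thesis using 3(2) by cases auto
    qed
  qed (use step[of i p] in \<open>auto simp: higher_layer_buffers\<close>)
  then show "R (Suc i) p d = R i p d" "E (Suc i) p d = E i p d" by auto
qed

lemma R_cases:
  obtains (same) "R (Suc i) p d = R i p d" | (R1) "act i p = Some (Forward d R1)"
  | (R2) "act i p = Some (Forward d R2)" | (R3) "act i p = Some (Forward d R3)"
  | (R5) "act i p = Some (Forward d R5)"
proof (cases "\<exists>\<rho>. act i p = Some (Forward d \<rho>)")
  case True
  then obtain \<rho> where \<rho>: "act i p = Some (Forward d \<rho>)" by blast
  then show thesis
  proof (cases \<rho>)
    case R4
    with \<rho> have "act i p = Some (Forward d R4)" by simp
    then show thesis by (rule R4_step) (use that(1) in simp)
  next
    case R6
    with \<rho> have "act i p = Some (Forward d R6)" by simp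
    then show thesis by (rule R6_step) (use that(1) in simp)
  qed (use \<rho> that in simp_all)
qed (use no_step that in blast)

lemma E_cases:
  obtains (same) "E (Suc i) p d = E i p d" | (R2) "act i p = Some (Forward d R2)"
  | (R4) "act i p = Some (Forward d R4)" | (R6) "act i p = Some (Forward d R6)"
proof (cases "\<exists>\<rho>. act i p = Some (Forward d \<rho>)")
  case True
  then obtain \<rho> where \<rho>: "act i p = Some (Forward d \<rho>)" by blast
  then show thesis
  proof (cases \<rho>)
    case R1
    with \<rho> have "act i p = Some (Forward d R1)" by simp
    then show thesis by (rule R1_step) (use that(1) in simp)
  next
    case R3
    with \<rho> have "act i p = Some (Forward d R3)" by simp
    then show thesis by (rule R3_step) (use that(1) in simp)
  next
    case R5
    with \<rho> have "act i p = Some (Forward d R5)" by simp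
    then show thesis by (rule R5_step) (use that(1) in simp)
  qed (use \<rho> that in simp_all)
qed (use no_step that in blast)

text \<open>Inductions on time ask for the origin of a message that has just appeared. R3 reads the
  \<open>bufE\<close> of the configuration before the step, which its owner may empty in the same
  step.\<close>

lemma R_new:
  assumes "R (Suc i) p d = Some x" "R i p d \<noteq> Some x"
  obtains (R1) m where "act i p = Some (Forward d R1)" "x = Msg m p 0 (Generated i p)"
      "waiting (cfg i p) = Some (m, d)"
  | (R3) m s q c g where "act i p = Some (Forward d R3)" "R i p d = None" "ch i p d = Some s"
      "s \<noteq> p" "s \<in> nbrs adj p" "hop A (cfg i) s d = p" "E i s d = Some (Msg m q c g)"
      "x = Msg m s c g"
proof (cases rule: R_cases[of i p d])
  case same
  then show thesis using assms by simp
next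
  case R1
  then show thesis by (rule R1_step) (use assms R1 that(1) in simp)
next
  case R2
  then show thesis by (rule R2_step) (use assms in simp)
next
  case R3
  then show thesis by (rule R3_step) (use assms R3 that(2) in simp)
next
  case R5
  then show thesis by (rule R5_step) (use assms in simp)
qed

lemma E_new:
  assumes "E (Suc i) p d = Some x" "E i p d \<noteq> Some x"
  obtains m q c g c' where "act i p = Some (Forward d R2)" "E i p d = None"
    "R i p d = Some (Msg m q c g)" "q = p \<or> (\<forall>q'. \<not> holds_msg (E i q d) m q' c)"
    "c' \<in> free_colors adj (cfg i) p d" "x = Msg m p c' g" "R (Suc i) p d = None"
proof (cases rule: E_cases[of i p d])
  case same
  then show thesis using assms by simp
next
  case R2
  then show thesis by (rule R2_step) (use assms R2 that in simp)
next
  case R4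
  then show thesis by (rule R4_step) (use assms in simp)
next
  case R6
  then show thesis by (rule R6_step) (use assms in simp)
qed

lemma R_left:
  assumes "R i p d = Some x" "R (Suc i) p d \<noteq> Some x"
  obtains (R2) "act i p = Some (Forward d R2)" | (R5) "act i p = Some (Forward d R5)"
proof (cases rule: R_cases[of i p d])
  case R1
  then show thesis by (rule R1_step) (use assms in simp)
next
  case R3
  then show thesis by (rule R3_step) (use assms in simp)
qed (use assms that in simp_all)

lemma E_left:
  assumes "E i p d = Some x" "E (Suc i) p d \<noteq> Some x"
  obtains (R4) "act i p = Some (Forward d R4)" | (R6) "act i p = Some (Forward d R6)"
proof (cases rule: E_cases[of i p d])
  case R2
  then show thesis by (rule R2_step) (use assms in simp)
qed (use assms that in simp_all)

section \<open>Copies of a message\<close>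

text \<open>Places the holder of a copy among the neighbours of its sender, which is where
  \<open>free_colors\<close> and the last guard of R4 look.\<close>

lemma sender_R: "R i p d = Some x \<Longrightarrow> sender x \<in> insert p (nbrs adj p)"
proof (induction i arbitrary: p x)
  case 0
  then show ?case using initial unfolding initial_configuration_def by blast
next
  case (Suc i)
  show ?case
  proof (cases "R i p d = Some x")
    case False
    with Suc.prems show ?thesis by (rule R_new) auto
  qed (use Suc.IH in blast)
qed

text \<open>Only R1 creates a generated identity, stamped with the current step; R2 and R3 carry
  \<open>info\<close> and \<open>ident\<close> along together and stay within one
  destination.\<close>

lemma ident_generated:
  assumes "R i p d = Some x \<or> E i p d = Some x" "ident x = Generated t s"
  shows "t < i \<and> generates cfg act t s (info x) d"
  using assms
proof (induction i arbitrary: p x)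
  case 0
  then show ?case using initial unfolding initial_configuration_def by fastforce
next
  case (Suc i)
  show ?case
  proof (cases "R i p d = Some x \<or> E i p d = Some x")
    case True
    then show ?thesis using Suc.IH Suc.prems(2) less_SucI by blast
  next
    case False
    then have "R i p d \<noteq> Some x" "E i p d \<noteq> Some x" by auto
    from Suc.prems(1) show ?thesis
    proof
      assume "R (Suc i) p d = Some x"
      from this \<open>R i p d \<noteq> Some x\<close> show ?thesis
      proof (cases rule: R_new)
        case R1
        then show ?thesis using Suc.prems(2) by (auto simp: generates_def)
      next
        case (R3 m s' q c g)
        then show ?thesis using Suc.IH[of s' "Msg m q c g"] Suc.prems(2) by auto
      qed
    next
      assume "E (Suc i) p d = Some x"
      from this \<open>E i p d \<noteq> Some x\<close> show ?thesis
      proof (rule E_new)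
        fix m q c g c' assume "R i p d = Some (Msg m q c g)" "x = Msg m p c' g"
        then show ?thesis using Suc.IH[of p "Msg m q c g"] Suc.prems(2) by auto
      qed
    qed
  qed
qed

text \<open>R2 picks a color that no neighbour holds, so a neighbour that later matches sender and color
  of \<open>bufE\<close> holds a copy of the same message.\<close>

lemma same_color_ident:
  assumes "R i r d = Some x" "sender x = p" "p \<noteq> r" "E i p d = Some y" "color y = color x"
  shows "ident y = ident x"
  using assms
proof (induction i arbitrary: x y)
  case 0
  then show ?case using initial unfolding initial_configuration_def by metis
next
  case (Suc i)
  show ?case
  proof (cases "R i r d = Some x")
    case True
    show ?thesis
    proof (cases "E i p d = Some y")
      case True
      then show ?thesis using Suc \<open>R i r d = Some x\<close> by blast
    next
      case False
      from Suc.prems(4) this show ?thesis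
      proof (rule E_new)
        fix m q c g c' assume c': "c' \<in> free_colors adj (cfg i) p d" "y = Msg m p c' g"
        have "r \<in> nbrs adj p"
          using sender_R[OF True] Suc.prems(2,3) nbrs_sym by auto
        then show ?thesis
          using c' True Suc.prems(5) unfolding free_colors_def by auto
      qed
    qed
  next
    case False
    from Suc.prems(1) this show ?thesis
    proof (cases rule: R_new)
      case R1
      then show ?thesis using Suc.prems by simp
    next
      case (R3 m s q c g)
      then have E: "E i p d = Some (Msg m q c g)" using Suc.prems by simp
      \<comment> \<open>\<open>bufE\<close> of \<open>p\<close> was full when R3 read it and R2
        fills only an empty buffer, so \<open>y\<close> is the message that was read.\<close>
      have "y = Msg m q c g"
      proof (rule ccontr)
        assume "y \<noteq> Msg m q c g"
        then have "E i p d \<noteq> Some y" using E by simp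
        from Suc.prems(4) this show False by (rule E_new) (use E in simp)
      qed
      then show ?thesis using R3 by simp
    qed
  qed
qed

text \<open>The next hop of \<open>d\<close> for destination \<open>d\<close> is \<open>d\<close>
  itself, so R3 never takes a message away from \<open>d\<close>. This is why R6 may erase without
  looking for copies.\<close>

lemma copy_from_destination_invalid:
  "R i r d = Some x \<Longrightarrow> sender x = d \<Longrightarrow> r \<noteq> d \<Longrightarrow> ident x = Initial"
proof (induction i arbitrary: x)
  case 0
  then show ?case using initial unfolding initial_configuration_def by blast
next
  case (Suc i)
  show ?case
  proof (cases "R i r d = Some x")
    case False
    with Suc.prems(1) show ?thesis
    proof (cases rule: R_new)
      case (R3 m s q c g)
      then show ?thesis using Suc.prems hop_self by auto
    qed (use Suc.prems in auto)
  qed (use Suc in blast)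
qed

definition holds_ident :: "('v, 'm) message option \<Rightarrow> 'v ident \<Rightarrow> bool" where
  "holds_ident b g \<longleftrightarrow> (\<exists>x. b = Some x \<and> ident x = g)"

text \<open>The copies of a valid message are either a single \<open>bufR\<close>, or one \<open>bufE\<^sub>p\<close> together with the
  \<open>bufR\<close> of some neighbours that took it from \<open>p\<close>.\<close>

definition copies_consistent :: "nat \<Rightarrow> 'v \<Rightarrow> 'v ident \<Rightarrow> bool" where
  "copies_consistent i d g \<longleftrightarrow>
     (\<forall>p p'. holds_ident (E i p d) g \<and> holds_ident (E i p' d) g \<longrightarrow> p = p') \<and>
     (\<forall>p r x y. E i p d = Some x \<and> ident x = g \<and> R i r d = Some y \<and> ident y = g \<longrightarrow>
        r \<noteq> p \<and> sender y = p \<and> color y = color x) \<and>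
     (\<forall>r r'. holds_ident (R i r d) g \<and> holds_ident (R i r' d) g \<and> r \<noteq> r' \<longrightarrow>
        (\<exists>p. holds_ident (E i p d) g))"

text \<open>Guards compare useful information whereas the invariants speak of identities; this links
  the two.\<close>

lemma ident_info_eq:
  assumes "R i p d = Some x \<or> E i p d = Some x" "R j q d = Some y \<or> E j q d = Some y"
    "ident x = Generated t s" "ident y = Generated t s"
  shows "info x = info y"
  using ident_generated[OF assms(1,3)] ident_generated[OF assms(2,4)] by (simp add: generates_def)

text \<open>By consistency, a further copy in some \<open>bufE\<close> would belong to the recorded
  sender and agree in color and information, which is what the guard of R2 excludes.\<close>

lemma R2_moves_single_copy:
  assumes cons: "copies_consistent i d (Generated t s)"
    and a: "act i p = Some (Forward d R2)" and R: "holds_ident (R i p d) (Generated t s)"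
  shows "\<not> holds_ident (E i q d) (Generated t s)"
  using a
proof (rule R2_step)
  fix m q' c g assume 1: "R i p d = Some (Msg m q' c g)"
    "q' = p \<or> (\<forall>q''. \<not> holds_msg (E i q' d) m q'' c)"
  then have g: "g = Generated t s" using R by (simp add: holds_ident_def)
  show ?thesis
  proof
    assume "holds_ident (E i q d) (Generated t s)"
    then obtain x where x: "E i q d = Some x" "ident x = Generated t s"
      by (auto simp: holds_ident_def)
    have "p \<noteq> q" "q' = q" "c = color x"
      using cons x 1 g unfolding copies_consistent_def by fastforce+
    moreover have "info x = m" using ident_info_eq[of i q d x i p "Msg m q' c g"] x 1 g by simp
    ultimately show False using 1(2) x(1) by (cases x) (auto simp: holds_msg_def)
  qed
qed

text \<open>Consistency gives every copy in a \<open>bufR\<close> the sender \<open>p\<close> and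
  the color of \<open>x\<close>. R4 checks that no neighbour except the next hop holds such a
  message, and a valid copy with sender \<open>d\<close> outside \<open>d\<close> does not exist,
  which rules out R6.\<close>

lemma R4_R6_copies:
  assumes cons: "copies_consistent i d (Generated t s)"
    and E: "E i p d = Some x" "ident x = Generated t s" and E': "E (Suc i) p d \<noteq> Some x"
    and R: "R i r d = Some y" "ident y = Generated t s"
  shows "act i p = Some (Forward d R4)" "r = hop A (cfg i) p d"
proof -
  have y: "r \<noteq> p" "sender y = p" "color y = color x"
    using cons E R unfolding copies_consistent_def by blast+
  have "act i p = Some (Forward d R4) \<and> r = hop A (cfg i) p d"
    using E(1) E'
  proof (cases rule: E_left)
    case R4
    then show ?thesis
    proof (rule R4_step)
      fix m q c g assume 1: "E i p d = Some (Msg m q c g)"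
        "\<And>r. r \<in> nbrs adj p \<Longrightarrow> r \<noteq> hop A (cfg i) p d \<Longrightarrow> \<not> holds_msg (R i r d) m p c"
      have "info y = info x" using ident_info_eq E R by blast
      then have "holds_msg (R i r d) m p c"
        using R y 1(1) E(1) by (cases y) (auto simp: holds_msg_def)
      moreover have "r \<in> nbrs adj p" using sender_R[OF R(1)] y nbrs_sym by auto
      ultimately show ?thesis using 1(2) R4 by blast
    qed
  next
    case R6
    then show ?thesis
    proof (rule R6_step)
      assume "p = d"
      then show ?thesis using copy_from_destination_invalid[OF R(1)] y R(2) by simp
    qed
  qed
  then show "act i p = Some (Forward d R4)" "r = hop A (cfg i) p d" by auto
qed

lemma copies_consistent: "copies_consistent i d (Generated t s)"
proof (induction i)
  case 0
  have "\<not> holds_ident (E 0 p d) (Generated t s)" "\<not> holds_ident (R 0 p d) (Generated t s)" for p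
    using ident_generated[of 0 p d _ t s] by (auto simp: holds_ident_def)
  then show ?case by (auto simp: copies_consistent_def holds_ident_def)
next
  case (Suc i)
  let ?g = "Generated t s"
  have E_old: "E i p d = Some x \<or>
      act i p = Some (Forward d R2) \<and> holds_ident (R i p d) ?g \<and> R (Suc i) p d = None"
    if "E (Suc i) p d = Some x" "ident x = ?g" for p x
  proof (cases "E i p d = Some x")
    case False
    show ?thesis using that(1) False by (rule E_new) (use that in \<open>auto simp: holds_ident_def\<close>)
  qed auto
  have R_old: "R i r d = Some y \<or> (r = s \<and> t = i) \<or>
      (\<exists>p x. E i p d = Some x \<and> R i r d = None \<and> ident x = ?g \<and> r \<in> nbrs adj p \<and>
         hop A (cfg i) p d = r \<and> sender y = p \<and> color y = color x)"
    if "R (Suc i) r d = Some y" "ident y = ?g" for r y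
  proof (cases "R i r d = Some y")
    case False
    from that(1) False show ?thesis
      by (cases rule: R_new) (use that nbrs_sym in auto)
  qed auto
  show ?case
  proof (cases "t = i")
    case True
    \<comment> \<open>Identities are stamped with their step, so no copy precedes the generation
      step, and after it only \<open>bufR\<close> of \<open>s\<close> can hold one.\<close>
    have fresh: "\<not> holds_ident (E i p d) ?g" "\<not> holds_ident (R i p d) ?g" for p
      using ident_generated[of i p d _ t s] True by (auto simp: holds_ident_def)
    then have "\<not> holds_ident (E (Suc i) p d) ?g" for p
      using E_old unfolding holds_ident_def by blast
    moreover have "r = s" if "holds_ident (R (Suc i) r d) ?g" for r
      using R_old[of r] that fresh unfolding holds_ident_def by blast
    ultimately show ?thesis
      unfolding copies_consistent_def by (metis holds_ident_def)
  next
    case False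
    \<comment> \<open>Two copies in distinct \<open>bufR\<close> would require one in a
      \<open>bufE\<close>, which R2 rules out.\<close>
    have single: "r = p" if "act i p = Some (Forward d R2)" "holds_ident (R i p d) ?g"
      "holds_ident (R i r d) ?g" for p r
      using that R2_moves_single_copy[OF Suc that(1,2)] Suc unfolding copies_consistent_def by blast
    have U1: "p = p'"
      if p: "holds_ident (E (Suc i) p d) ?g" "holds_ident (E (Suc i) p' d) ?g" for p p'
    proof -
      obtain x x' where x: "E (Suc i) p d = Some x" "ident x = ?g" "E (Suc i) p' d = Some x'"
        "ident x' = ?g" using p by (auto simp: holds_ident_def)
      have no: False if "act i q = Some (Forward d R2)" "holds_ident (R i q d) ?g"
        "E i q' d = Some z" "ident z = ?g" for q q' z
        using R2_moves_single_copy[OF Suc that(1,2), of q'] that(3,4)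
        by (auto simp: holds_ident_def)
      from E_old[OF x(1,2)] E_old[OF x(3,4)] show ?thesis
        using no x(2,4) single Suc unfolding copies_consistent_def
        by (metis holds_ident_def)
    qed
    have U2: "r \<noteq> p \<and> sender y = p \<and> color y = color x"
      if x: "E (Suc i) p d = Some x" "ident x = ?g" and y: "R (Suc i) r d = Some y" "ident y = ?g"
      for p r x y
    proof (cases "E i p d = Some x")
      case E: True
      show ?thesis
      proof (cases "R i r d = Some y")
        case True
        then show ?thesis using Suc E x y unfolding copies_consistent_def by blast
      next
        case r: False
        then obtain p' x' where p': "E i p' d = Some x'" "ident x' = ?g" "r \<in> nbrs adj p'"
          "sender y = p'" "color y = color x'"
          using R_old[OF y] False by auto
        then have "p' = p"
          using Suc E x(2) unfolding copies_consistent_def by (metis holds_ident_def)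
        then show ?thesis using p' E nbrs_irrefl by auto
      qed
    next
      case E: False
      then have 2: "act i p = Some (Forward d R2)" "holds_ident (R i p d) ?g" "R (Suc i) p d = None"
        using E_old[OF x] by auto
      then have "R i r d = Some y"
        using R_old[OF y] R2_moves_single_copy[OF Suc 2(1,2)] False
        unfolding holds_ident_def by blast
      then have "r = p" using single[OF 2(1,2)] y(2) by (auto simp: holds_ident_def)
      then show ?thesis using 2 y by simp
    qed
    have U3: "\<exists>p. holds_ident (E (Suc i) p d) ?g"
      if r: "holds_ident (R (Suc i) r d) ?g" "holds_ident (R (Suc i) r' d) ?g" "r \<noteq> r'" for r r'
    proof -
      obtain y y' where y: "R (Suc i) r d = Some y" "ident y = ?g" "R (Suc i) r' d = Some y'"
        "ident y' = ?g" using r by (auto simp: holds_ident_def)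
      \<comment> \<open>While \<open>q\<close> takes its copy, \<open>bufE\<close> of
        \<open>p\<close> survives the step: R4 would need the copy to be at \<open>q\<close>
        already, and R6 would make \<open>p\<close> the destination, which designates no
        neighbour.\<close>
      have new: "\<exists>p. holds_ident (E (Suc i) p d) ?g"
        if z: "R (Suc i) q d = Some z" "ident z = ?g" "R i q d \<noteq> Some z" for q z
      proof -
        obtain p x where p: "E i p d = Some x" "ident x = ?g" "R i q d = None"
          "hop A (cfg i) p d = q" "q \<in> nbrs adj p"
          using R_old[OF z(1,2)] z(3) False by auto
        have "E (Suc i) p d = Some x"
        proof (rule ccontr)
          assume "E (Suc i) p d \<noteq> Some x"
          with p(1) show False
          proof (cases rule: E_left)
            case R4
            then show False by (rule R4_step) (use p in \<open>auto simp: holds_msg_def\<close>)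
          next
            case R6
            then show False by (rule R6_step) (use p in \<open>auto simp: hop_self nbrs_irrefl\<close>)
          qed
        qed
        then show ?thesis using p(2) by (auto simp: holds_ident_def)
      qed
      show ?thesis
      proof (cases "R i r d = Some y \<and> R i r' d = Some y'")
        case True
        then have "\<exists>p. holds_ident (E i p d) ?g"
          using Suc y r(3) unfolding copies_consistent_def by (metis holds_ident_def)
        then obtain p x where p: "E i p d = Some x" "ident x = ?g" by (auto simp: holds_ident_def)
        \<comment> \<open>Otherwise both \<open>r\<close> and \<open>r'\<close> would be the next
          hop of \<open>p\<close>.\<close>
        have "E (Suc i) p d = Some x"
          using R4_R6_copies(2)[OF Suc p] True y r(3) by metis
        then show ?thesis using p(2) by (auto simp: holds_ident_def)
      qed (use new y in blast)
    qed
    show ?thesis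
      unfolding copies_consistent_def using U1 U2 U3 by blast
  qed
qed

text \<open>The match seen by R4 is a true copy by the color argument. The next hop cannot drop it
  in the same step: R2 is blocked by the matching \<open>bufE\<close> of \<open>p\<close>, and R5 by
  the correct next hop.\<close>

lemma R4_hands_over:
  assumes a: "act i p = Some (Forward d R4)" and x: "E i p d = Some x"
  obtains y where "R (Suc i) (hop A (cfg i) p d) d = Some y" "sender y = p" "ident y = ident x"
  using a
proof (rule R4_step)
  let ?r = "hop A (cfg i) p d"
  fix m q c g assume 1: "E i p d = Some (Msg m q c g)" "p \<noteq> d" "holds_msg (R i ?r d) m p c"
  then obtain g' where y: "R i ?r d = Some (Msg m p c g')" by (auto simp: holds_msg_def)
  have r: "p \<noteq> ?r" using hop_nbr[OF 1(2)] nbrs_irrefl by metis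
  have "R (Suc i) ?r d = Some (Msg m p c g')"
  proof (rule ccontr)
    assume "R (Suc i) ?r d \<noteq> Some (Msg m p c g')"
    with y show False
    proof (cases rule: R_left)
      case R2
      then show False by (rule R2_step) (use y r 1 in \<open>auto simp: holds_msg_def\<close>)
    next
      case R5
      then show False by (rule R5_step) (use y in auto)
    qed
  qed
  moreover have "g = g'"
    using same_color_ident[OF y _ r 1(1)] by simp
  ultimately show thesis using that 1(1) x by auto
qed

text \<open>R2 moves the message, and R5 leaves the copy of its sender by the color argument.
  Recording the wrong next hop in the second alternative allows stable tables to exclude it for
  well-routed copies.\<close>

lemma R_left_copy:
  assumes "R i r d = Some y" "R (Suc i) r d \<noteq> Some y"
  shows "(\<exists>x. E (Suc i) r d = Some x \<and> ident x = ident y) \<or>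
    (\<exists>x. hop A (cfg i) (sender y) d \<noteq> r \<and> E i (sender y) d = Some x \<and> ident x = ident y)"
  using assms
proof (cases rule: R_left)
  case R2
  then show ?thesis by (rule R2_step) (use assms in auto)
next
  case R5
  then show ?thesis
  proof (rule R5_step)
    fix m q c g q' assume 1: "R i r d = Some (Msg m q c g)" "q \<noteq> r" "holds_msg (E i q d) m q' c"
      "hop A (cfg i) q d \<noteq> r"
    then obtain g' where "E i q d = Some (Msg m q' c g')" by (auto simp: holds_msg_def)
    moreover from this have "g' = g" using same_color_ident[OF 1(1) _ 1(2)] by simp
    ultimately show ?thesis using 1 assms by auto
  qed
qed

section \<open>Survival of a message and uniqueness of its delivery\<close>

definition present :: "nat \<Rightarrow> 'v \<Rightarrow> 'v ident \<Rightarrow> bool" where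
  "present i d g \<longleftrightarrow> (\<exists>p. holds_ident (E i p d) g \<or> holds_ident (R i p d) g)"

text \<open>A copy leaves \<open>bufE\<close> only by R4, which leaves one at the next hop, or by
  R6, which delivers it. If there is none in any \<open>bufE\<close>, then a \<open>bufR\<close> can
  lose its copy only by R2.\<close>

lemma not_lost:
  assumes "present i d g"
  shows "present (Suc i) d g \<or> (\<exists>m. delivers cfg act i d m g)"
proof -
  have E: ?thesis if x: "E i p d = Some x" "ident x = g" for p x
  proof (cases "E (Suc i) p d = Some x")
    case True
    then show ?thesis using x by (auto simp: present_def holds_ident_def)
  next
    case False
    from x(1) False show ?thesis
    proof (cases rule: E_left)
      case R4
      then show ?thesis
        by (rule R4_hands_over[OF _ x(1)]) (use x in \<open>auto simp: present_def holds_ident_def\<close>)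
    next
      case R6
      then show ?thesis by (rule R6_step) (use R6 x in \<open>auto simp: delivers_def\<close>)
    qed
  qed
  show ?thesis
  proof (cases "\<exists>p. holds_ident (E i p d) g")
    case True
    then show ?thesis using E by (auto simp: holds_ident_def)
  next
    case False
    then obtain r y where y: "R i r d = Some y" "ident y = g"
      using assms by (auto simp: present_def holds_ident_def)
    show ?thesis
    proof (cases "R (Suc i) r d = Some y")
      case True
      then show ?thesis using y by (auto simp: present_def holds_ident_def)
    next
      case False
      then show ?thesis
        using R_left_copy[OF y(1) False] E y(2) by (auto simp: present_def holds_ident_def)
    qed
  qed
qed

text \<open>The delivered copy is the only one in any \<open>bufE\<close>, and one in a
  \<open>bufR\<close> would have sender \<open>d\<close>. No copy arises during the step either: R2
  has none to move, and R3 cannot take from \<open>d\<close>.\<close>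

lemma delivered_not_present:
  assumes "delivers cfg act i d m (Generated t s)"
  shows "\<not> present (Suc i) d (Generated t s)"
proof -
  let ?g = "Generated t s"
  obtain x where a: "act i d = Some (Forward d R6)" and x: "E i d d = Some x" "ident x = ?g"
    using assms by (auto simp: delivers_def)
  have t: "t < i" using ident_generated x by blast
  have gone: "E (Suc i) d d = None" using a by (rule R6_step)
  have unique: "p = d" if "holds_ident (E i p d) ?g" for p
    using copies_consistent[of i d t s] x that unfolding copies_consistent_def
    by (metis holds_ident_def)
  have "\<not> holds_ident (E (Suc i) p d) ?g" for p
  proof
    assume "holds_ident (E (Suc i) p d) ?g"
    then obtain y where y: "E (Suc i) p d = Some y" "ident y = ?g" by (auto simp: holds_ident_def)
    show False
    proof (cases "E i p d = Some y")
      case True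
      then show False using unique[of p] y gone by (auto simp: holds_ident_def)
    next
      case False
      from y(1) False show False
      proof (rule E_new)
        fix m q c g c' assume "act i p = Some (Forward d R2)" "R i p d = Some (Msg m q c g)"
          "y = Msg m p c' g"
        then show False
          using R2_moves_single_copy[OF copies_consistent, of i p d t s d] x y(2)
          by (auto simp: holds_ident_def)
      qed
    qed
  qed
  moreover have "\<not> holds_ident (R (Suc i) r d) ?g" for r
  proof
    assume "holds_ident (R (Suc i) r d) ?g"
    then obtain y where y: "R (Suc i) r d = Some y" "ident y = ?g" by (auto simp: holds_ident_def)
    show False
    proof (cases "R i r d = Some y")
      case True
      then have "r \<noteq> d" "sender y = d"
        using copies_consistent[of i d t s] x y(2) unfolding copies_consistent_def by blast+
      then show False using copy_from_destination_invalid[OF True] y(2) by simp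
    next
      case False
      from y(1) False show False
      proof (cases rule: R_new)
        case R1
        then show False using t y(2) by simp
      next
        case (R3 m s' q c g)
        then have "s' = d" using unique[of s'] y(2) by (auto simp: holds_ident_def)
        then show False using R3 hop_self by metis
      qed
    qed
  qed
  ultimately show ?thesis by (simp add: present_def)
qed

text \<open>After step \<open>t\<close>, R1 stamps other identities, and the remaining rules only
  copy existing ones.\<close>

lemma not_present_forever:
  assumes "j \<ge> i" "t < i" "\<not> present i d (Generated t s)"
  shows "\<not> present j d (Generated t s)"
  using assms
proof (induction rule: dec_induct)
  case (step j)
  let ?g = "Generated t s"
  have no: "E j p d = Some x \<Longrightarrow> ident x \<noteq> ?g" "R j p d = Some x \<Longrightarrow> ident x \<noteq> ?g" for p x
    using step.IH[OF step.prems] unfolding present_def holds_ident_def by blast+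
  have "ident x \<noteq> ?g" if x: "E (Suc j) p d = Some x" for p x
  proof (cases "E j p d = Some x")
    case False
    with x show ?thesis
    proof (rule E_new)
      fix m q c g c' assume "R j p d = Some (Msg m q c g)" "x = Msg m p c' g"
      then show ?thesis using no(2)[of p "Msg m q c g"] by simp
    qed
  qed (rule no)
  moreover have "ident y \<noteq> ?g" if y: "R (Suc j) r d = Some y" for r y
  proof (cases "R j r d = Some y")
    case False
    from y False show ?thesis
    proof (cases rule: R_new)
      case R1
      then show ?thesis using step.hyps step.prems by simp
    next
      case (R3 m s' q c g)
      then show ?thesis using no(1)[of s' "Msg m q c g"] by simp
    qed
  qed (rule no)
  ultimately show ?case unfolding present_def holds_ident_def by blast
qed

lemma delivers_unique:
  assumes "generates cfg act t s m d" "delivers cfg act j q m' (Generated t s)"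
  shows "q = d \<and> m' = m \<and> t < j"
proof -
  obtain x where "E j q q = Some x" "ident x = Generated t s" "info x = m'"
    using assms(2) by (auto simp: delivers_def)
  then have "t < j" "generates cfg act t s m' q"
    using ident_generated[of j q q x t s] by simp_all
  then show ?thesis using assms(1) by (simp add: generates_def)
qed

lemma delivers_once:
  assumes "delivers cfg act j d m (Generated t s)" "delivers cfg act j' d m' (Generated t s)"
  shows "j = j'"
proof -
  have "\<not> j < j'" if del: "delivers cfg act j d m (Generated t s)"
    "delivers cfg act j' d m' (Generated t s)" for j j' m m'
  proof
    assume "j < j'"
    obtain x where "E j d d = Some x" "ident x = Generated t s"
      using del(1) by (auto simp: delivers_def)
    then have "t < Suc j" using ident_generated[of j d d x t s] by simp
    then have "\<not> present j' d (Generated t s)"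
      using not_present_forever[of "Suc j" j' t d s] delivered_not_present[OF del(1)] \<open>j < j'\<close>
      by simp
    moreover have "holds_ident (E j' d d) (Generated t s)"
      using del(2) by (auto simp: holds_ident_def delivers_def)
    ultimately show False by (auto simp: present_def)
  qed
  then show ?thesis using assms by (meson linorder_neqE_nat)
qed

lemma present_until_delivered:
  assumes "generates cfg act t s m d" "i > t"
  shows "present i d (Generated t s) \<or> (\<exists>j m'. delivers cfg act j d m' (Generated t s))"
proof -
  have "Suc t \<le> i" using assms(2) by simp
  then show ?thesis
  proof (induction rule: dec_induct)
    case base
    have "act t s = Some (Forward d R1)" using assms(1) by (simp add: generates_def)
    then show ?case by (rule R1_step) (force simp: present_def holds_ident_def)
  next
    case (step j)
    then show ?case using not_lost[of j d "Generated t s"] by blast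
  qed
qed

section \<open>Stabilization in the composed execution\<close>

lemma route_step:
  "act i p = Some Route \<Longrightarrow> table (cfg (Suc i) p) \<in> moves A p (\<lambda>q. table (cfg i q))"
  "act i p \<noteq> Some Route \<Longrightarrow> table (cfg (Suc i) p) = table (cfg i p)"
proof -
  show "table (cfg (Suc i) p) \<in> moves A p (\<lambda>q. table (cfg i q))" if "act i p = Some Route"
    using step[of i p] that by (auto simp: higher_layer_buffers)
  show "table (cfg (Suc i) p) = table (cfg i p)" if nr: "act i p \<noteq> Some Route"
  proof (cases "act i p")
    case None
    then show ?thesis using step[of i p] by (auto simp: higher_layer_buffers)
  next
    case (Some a)
    then obtain d \<rho> where "act i p = Some (Forward d \<rho>)" using nr by (cases a) auto
    then show ?thesis
    proof (rule forward_step)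
      fix s assume "forward_move adj A i (cfg i) (ch i) p d \<rho> s" "table (cfg (Suc i) p) = table s"
      then show ?thesis by cases simp_all
    qed
  qed
qed

text \<open>Priority leaves \<open>Route\<close> as the only action of such a processor, so fairness
  of the composed execution yields fairness of the routing algorithm.\<close>

lemma routing_priority:
  assumes "\<And>j. j \<ge> i \<Longrightarrow> routing_enabled A (cfg j) p"
  shows "\<exists>j\<ge>i. act j p = Some Route"
proof -
  have "\<forall>j\<ge>i. enabled adj A j (cfg j) (ch j) p" using assms by (simp add: enabled_def)
  then obtain j where j: "j \<ge> i" "act j p \<noteq> None"
    using weakly_fair unfolding weakly_fair_def by blast
  then have "act j p = Some Route"
  proof (cases "act j p")
    case (Some a)
    then show ?thesis
      using assms[OF j(1)] by (cases a) (auto elim: forward_step)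
  qed simp
  then show ?thesis using j(1) by blast
qed

lemma tables_stabilize:
  obtains T h where "\<And>i p. i \<ge> T \<Longrightarrow> \<not> routing_enabled A (cfg i) p"
    "\<And>i p d. i \<ge> T \<Longrightarrow> hop A (cfg i) p d = h d p" "\<And>p d. \<exists>k. (h d ^^ k) p = d"
proof -
  let ?\<sigma> = "\<lambda>i q. table (cfg i q)" and ?S = "\<lambda>i. {p. act i p = Some Route}"
  have "\<exists>k. (\<forall>p. moves A p (?\<sigma> k) = {}) \<and> correct_tables adj A (?\<sigma> k)"
  proof (rule stuttering_routing_stabilizes[where S = ?S, OF stabilizing])
    fix i p assume "\<And>j. j \<ge> i \<Longrightarrow> moves A p (?\<sigma> j) \<noteq> {}"
    then show "\<exists>j\<ge>i. p \<in> ?S j"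
      using routing_priority[of i p] by (auto simp: routing_enabled_def)
  qed (use route_step in auto)
  then obtain T where T: "\<And>p. moves A p (?\<sigma> T) = {}" "correct_tables adj A (?\<sigma> T)" by blast
  \<comment> \<open>Silence: with no routing move available at \<open>T\<close>, the tables can
    never change again.\<close>
  have eq: "?\<sigma> i = ?\<sigma> T" if "i \<ge> T" for i
    using that
  proof (induction rule: dec_induct)
    case (step j)
    then have "act j p \<noteq> Some Route" for p using route_step(1)[of j p] T(1) by auto
    then show ?case using route_step(2) step.IH by (simp add: fun_eq_iff)
  qed simp
  show thesis
  proof (rule that[of T "\<lambda>d p. next_hop A p (table (cfg T p)) d"])
    fix i p d assume i: "i \<ge> T"
    show "\<not> routing_enabled A (cfg i) p"
      unfolding routing_enabled_def eq[OF i] using T(1) by simp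
    show "hop A (cfg i) p d = next_hop A p (table (cfg T p)) d"
      unfolding hop_def using fun_cong[OF eq[OF i], of p] by simp
  next
    fix p d
    show "\<exists>k. ((\<lambda>p. next_hop A p (table (cfg T p)) d) ^^ k) p = d"
      using T(2) unfolding correct_tables_def by blast
  qed
qed

text \<open>Pigeonhole: there is one more color than the maximal number of neighbours.\<close>

lemma free_color_exists: "\<exists>c. c \<in> free_colors adj C p d"
proof -
  \<comment> \<open>An empty buffer contributes an unspecified number, which keeps the bound of one
    element per neighbour.\<close>
  let ?U = "(\<lambda>q. color (the (bufR (C q) d))) ` nbrs adj p"
  have "card ?U \<le> card (nbrs adj p)" by (rule card_image_le) simp
  also have "\<dots> \<le> max_degree adj" unfolding max_degree_def by (rule Max_ge) auto
  finally have "card ?U < card {..max_degree adj}" by simp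
  moreover have "finite ?U" by simp
  ultimately have "\<not> {..max_degree adj} \<subseteq> ?U" using card_mono leD by blast
  then obtain c where "c \<le> max_degree adj" "c \<notin> ?U" by auto
  then have "c \<in> free_colors adj C p d" by (force simp: free_colors_def)
  then show ?thesis ..
qed

end

section \<open>Progress under stable tables\<close>

text \<open>From time \<open>T\<close> on the routing algorithm is silent and \<open>h d\<close> is
  the constant next-hop map towards \<open>d\<close>.\<close>

locale stable_execution = ssmfp_execution adj A cfg act ch
  for adj :: "'v::finite \<Rightarrow> 'v \<Rightarrow> bool"
    and A :: "('v, 'r) routing"
    and cfg :: "nat \<Rightarrow> ('v, 'm, 'r) config"
    and act :: "nat \<Rightarrow> 'v \<Rightarrow> 'v action option"
    and ch :: "nat \<Rightarrow> 'v \<Rightarrow> 'v \<Rightarrow> 'v option" +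
  fixes T :: nat and h :: "'v \<Rightarrow> 'v \<Rightarrow> 'v"
  assumes quiet: "i \<ge> T \<Longrightarrow> \<not> routing_enabled A (cfg i) p"
    and hop_stable: "i \<ge> T \<Longrightarrow> hop A (cfg i) p d = h d p"
    and reaches: "\<exists>k. (h d ^^ k) p = d"
begin

lemma h_self: "h d d = d"
  using hop_stable[of T d d] by (simp add: hop_self)

lemma h_nbr: "p \<noteq> d \<Longrightarrow> h d p \<in> nbrs adj p"
  using hop_stable[of T p d] hop_nbr[of p d "cfg T"] by simp

section \<open>Consequences of fairness for a permanently enabled instance\<close>

abbreviation en :: "nat \<Rightarrow> 'v \<Rightarrow> 'v \<Rightarrow> bool" where
  "en i p d \<equiv> instance_enabled adj A i (cfg i) (ch i) p d"

lemma enI: "i \<ge> T \<Longrightarrow> forward_move adj A i (cfg i) (ch i) p d \<rho> s \<Longrightarrow> en i p d"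
  using quiet by (auto simp: instance_enabled_def)

lemma en_executed:
  assumes "\<And>j. j \<ge> i \<Longrightarrow> en j p d"
  obtains j \<rho> where "j \<ge> i" "act j p = Some (Forward d \<rho>)"
  using assms weakly_fair unfolding weakly_fair_def by blast

text \<open>R1, R3 and R5 alone cannot be executed forever: once the tables are stable, R5 never empties
  what R1 or R3 have put into \<open>bufR\<close>.\<close>

lemma E_stuck_not_enabled:
  assumes i: "i \<ge> T" and E: "\<And>j. j \<ge> i \<Longrightarrow> E j p d \<noteq> None"
    and en: "\<And>j. j \<ge> i \<Longrightarrow> en j p d"
  shows False
proof -
  \<comment> \<open>Rank 2 is a misrouted copy that R5 may still remove, 1 an empty buffer, 0 a
    message that R5 cannot remove. R5 leads from 2 to 1, R1 and R3 from 1 to 0, and a full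
    \<open>bufE\<close> blocks R2.\<close>
  define \<mu> :: "nat \<Rightarrow> nat" where
    "\<mu> j = (case R j p d of None \<Rightarrow> 1
      | Some x \<Rightarrow> if sender x = p \<or> h d (sender x) = p then 0 else 2)" for j
  have dec: "\<mu> (Suc j) < \<mu> j" if j: "j \<ge> i" and a: "act j p = Some (Forward d \<rho>)" for j \<rho>
  proof -
    have T: "j \<ge> T" using i j by simp
    show ?thesis
    proof (cases \<rho>)
      case R1
      with a have "act j p = Some (Forward d R1)" by simp
      then show ?thesis by (rule R1_step) (simp add: \<mu>_def)
    next
      case R2
      with a have "act j p = Some (Forward d R2)" by simp
      then show ?thesis by (rule R2_step) (use E[of j] j in simp)
    next
      case R3
      with a have "act j p = Some (Forward d R3)" by simp
      then show ?thesis by (rule R3_step) (use hop_stable[OF T] in \<open>simp add: \<mu>_def\<close>)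
    next
      case R4
      with a have "act j p = Some (Forward d R4)" by simp
      then show ?thesis by (rule R4_step) (use E[of "Suc j"] j in simp)
    next
      case R5
      with a have "act j p = Some (Forward d R5)" by simp
      then show ?thesis by (rule R5_step) (use hop_stable[OF T] in \<open>simp add: \<mu>_def\<close>)
    next
      case R6
      with a have "act j p = Some (Forward d R6)" by simp
      then show ?thesis by (rule R6_step) (use E[of "Suc j"] j in simp)
    qed
  qed
  have mono: "\<mu> (Suc j) \<le> \<mu> j" if "j \<ge> i" for j
  proof (cases "\<exists>\<rho>. act j p = Some (Forward d \<rho>)")
    case True
    then show ?thesis using dec[OF that] by (meson less_imp_le)
  next
    case False
    then show ?thesis using no_step[of j p d] by (simp add: \<mu>_def)
  qed
  have "False" if "j \<ge> i" "\<mu> j = n" for j n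
    using that
  proof (induction n arbitrary: j rule: less_induct)
    case (less n)
    have "en k p d" if "k \<ge> j" for k using en[of k] that less.prems(1) by simp
    then obtain k \<rho> where k: "k \<ge> j" "act k p = Some (Forward d \<rho>)"
      by (rule en_executed)
    have "\<mu> k \<le> \<mu> j"
      using k(1)
    proof (induction rule: dec_induct)
      case (step l)
      then show ?case using mono[of l] less.prems(1) by simp
    qed simp
    then have "\<mu> (Suc k) < n" using dec[OF _ k(2)] k(1) less.prems by simp
    then show False using less.IH[of "\<mu> (Suc k)" "Suc k"] k(1) less.prems(1) by simp
  qed
  then show False by blast
qed

text \<open>R4 and R6 need a full \<open>bufE\<close> and empty it, so a second such step requires
  R2 in between.\<close>

lemma R_rule_executed:
  assumes en: "\<And>j. j \<ge> i \<Longrightarrow> en j p d"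
  obtains j \<rho> where "j \<ge> i" "act j p = Some (Forward d \<rho>)" "\<rho> \<in> {R1, R2, R3, R5}"
proof -
  obtain j \<rho> where j: "j \<ge> i" "act j p = Some (Forward d \<rho>)" using en_executed en by blast
  show thesis
  proof (cases "\<rho> \<in> {R1, R2, R3, R5}")
    case True
    then show thesis using that j by blast
  next
    case False
    then have "act j p = Some (Forward d R4) \<or> act j p = Some (Forward d R6)"
      using j(2) by (cases \<rho>) auto
    then have E: "E (Suc j) p d = None" by (auto elim: R4_step R6_step)
    show thesis
    proof (rule ccontr)
      assume "\<not> thesis"
      then have no: "act k p \<noteq> Some (Forward d \<rho>)" if "k \<ge> i" "\<rho> \<in> {R1, R2, R3, R5}" for k \<rho>
        using \<open>\<And>j \<rho>. \<lbrakk>j \<ge> i; act j p = Some (Forward d \<rho>); \<rho> \<in> {R1, R2, R3, R5}\<rbrakk> \<Longrightarrow> thesis\<close> that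
        by blast
      have E': "E k p d = None" if "k \<ge> Suc j" for k
        using that
      proof (induction rule: dec_induct)
        case (step l)
        show ?case
        proof (rule ccontr)
          assume "E (Suc l) p d \<noteq> None"
          then obtain x where "E (Suc l) p d = Some x" "E l p d \<noteq> Some x" using step by auto
          then show False by (rule E_new) (use no[of l R2] step j in auto)
        qed
      qed (rule E)
      have "en k p d" if "k \<ge> Suc j" for k using en[of k] that j(1) by simp
      then obtain k \<rho>' where k: "k \<ge> Suc j" "act k p = Some (Forward d \<rho>')"
        by (rule en_executed)
      then have "act k p = Some (Forward d R4) \<or> act k p = Some (Forward d R6)"
        using no[of k \<rho>'] j(1) by (cases \<rho>') auto
      then show False using E'[OF k(1)] by (auto elim: R4_step R6_step)
    qed
  qed
qed

text \<open>Each rule that changes \<open>bufR\<close> finds it empty or leaves it empty.\<close>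

lemma R_stuck_not_enabled:
  assumes R: "\<And>j. j \<ge> i \<Longrightarrow> R j p d \<noteq> None" and en: "\<And>j. j \<ge> i \<Longrightarrow> en j p d"
  shows False
proof -
  obtain j \<rho> where j: "j \<ge> i" "act j p = Some (Forward d \<rho>)" "\<rho> \<in> {R1, R2, R3, R5}"
    using R_rule_executed en by blast
  then have "act j p = Some (Forward d R1) \<or> act j p = Some (Forward d R2)
    \<or> act j p = Some (Forward d R3) \<or> act j p = Some (Forward d R5)" by auto
  then have "R j p d = None \<or> R (Suc j) p d = None"
    by (auto elim: R1_step R2_step R3_step R5_step)
  then show False using R[of j] R[of "Suc j"] j(1) by auto
qed

section \<open>Draining of the buffers along the routes\<close>

definition E_drains :: "'v \<Rightarrow> 'v \<Rightarrow> bool" where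
  "E_drains p d \<longleftrightarrow> (\<forall>i\<ge>T. \<forall>x. E i p d = Some x \<longrightarrow> (\<exists>j\<ge>i. E j p d \<noteq> Some x))"

definition R_drains :: "'v \<Rightarrow> 'v \<Rightarrow> bool" where
  "R_drains p d \<longleftrightarrow> (\<forall>i\<ge>T. \<forall>x. R i p d = Some x \<longrightarrow> (\<exists>j\<ge>i. R j p d \<noteq> Some x))"

lemma E_drains_destination: "E_drains d d"
  unfolding E_drains_def
proof (intro allI impI, rule ccontr)
  fix i x assume i: "i \<ge> T" and "\<not> (\<exists>j\<ge>i. E j d d \<noteq> Some x)"
  then have E: "E j d d = Some x" if "j \<ge> i" for j using that by blast
  then have "en j d d" if "j \<ge> i" for j
    using enI[OF _ forward_move.R6] that i by (cases x) auto
  then show False using E_stuck_not_enabled[OF i, of d d] E by simp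
qed

text \<open>As long as both messages stand, R5 is enabled at \<open>r\<close>, which contradicts a
  \<open>bufR\<close> that stays full.\<close>

lemma misrouted_copy_removed:
  assumes i: "i \<ge> T" and q: "q \<noteq> r" "h d q \<noteq> r"
    and E: "\<And>j. j \<ge> i \<Longrightarrow> \<exists>q'. holds_msg (E j q d) m q' c"
  shows "\<exists>j\<ge>i. \<not> holds_msg (R j r d) m q c"
proof (rule ccontr)
  assume "\<not> ?thesis"
  then have R: "holds_msg (R j r d) m q c" if "j \<ge> i" for j using that by blast
  have "en j r d" if "j \<ge> i" for j
  proof -
    obtain g q' where "R j r d = Some (Msg m q c g)" "holds_msg (E j q d) m q' c"
      using R E \<open>j \<ge> i\<close> unfolding holds_msg_def by blast
    moreover have "j \<ge> T" using i that by simp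
    moreover have "hop A (cfg j) q d \<noteq> r" using hop_stable[OF \<open>j \<ge> T\<close>] q(2) by simp
    ultimately show ?thesis using enI[OF _ forward_move.R5] q(1) by blast
  qed
  moreover have "R j r d \<noteq> None" if "j \<ge> i" for j
    using R[OF that] by (auto simp: holds_msg_def)
  ultimately show False using R_stuck_not_enabled by blast
qed

text \<open>R3 at \<open>r\<close> takes only from processors whose next hop is \<open>r\<close>,
  and R1 records \<open>r\<close> itself as sender.\<close>

lemma misrouted_copy_not_created:
  assumes "i \<ge> T" "j \<ge> i" "q \<noteq> r" "h d q \<noteq> r" "\<not> holds_msg (R i r d) m q c"
  shows "\<not> holds_msg (R j r d) m q c"
  using assms(2)
proof (induction rule: dec_induct)
  case (step k)
  show ?case
  proof
    assume "holds_msg (R (Suc k) r d) m q c"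
    then obtain g where "R (Suc k) r d = Some (Msg m q c g)" by (auto simp: holds_msg_def)
    moreover from this have "R k r d \<noteq> Some (Msg m q c g)"
      using step by (auto simp: holds_msg_def)
    ultimately show False
      by (cases rule: R_new) (use assms step hop_stable[of k q d] in auto)
  qed
qed (rule assms)

text \<open>If \<open>bufR\<^sub>p\<close> never drains, then \<open>bufE\<close> of its sender is eventually emptied by R4, after R5 has
  removed the misrouted copies, and R2 cannot refill it with the same color.\<close>

lemma sender_releases:
  assumes i: "i \<ge> T" and R: "\<And>j. j \<ge> i \<Longrightarrow> R j p d = Some (Msg m q c g)" and q: "q \<noteq> p"
  shows "\<exists>k\<ge>i. \<forall>j\<ge>k. \<forall>q'. \<not> holds_msg (E j q d) m q' c"
proof -
  have p: "p \<in> nbrs adj q" using sender_R[OF R[of i]] q nbrs_sym by auto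
  have "\<exists>k\<ge>i. \<forall>q'. \<not> holds_msg (E k q d) m q' c"
  proof (rule ccontr)
    assume "\<not> ?thesis"
    then have E: "\<exists>q'. holds_msg (E k q d) m q' c" if "k \<ge> i" for k using that by blast
    show False
    proof (cases "h d q = p")
      \<comment> \<open>Here the stuck message at \<open>p\<close> is itself misrouted, and R5 would
        remove it.\<close>
      case False
      then show False
        using misrouted_copy_removed[OF i q False E] R by (auto simp: holds_msg_def)
    next
      case True
      then have "q \<noteq> d" using h_self q by auto
      have "\<exists>k\<ge>i. \<forall>j\<ge>k. \<not> holds_msg (R j r d) m q c" if r: "r \<in> nbrs adj q - {p}" for r
      proof -
        have r': "q \<noteq> r" "h d q \<noteq> r" using r True nbrs_irrefl by auto
        then obtain k where "k \<ge> i" "\<not> holds_msg (R k r d) m q c"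
          using misrouted_copy_removed[OF i r' E] by blast
        then show ?thesis using misrouted_copy_not_created[OF _ _ r', of k] i by (meson order_trans)
      qed
      then obtain K where K: "\<And>r. r \<in> nbrs adj q - {p} \<Longrightarrow>
          K r \<ge> i \<and> (\<forall>j\<ge>K r. \<not> holds_msg (R j r d) m q c)"
        by metis
      \<comment> \<open>A common time after which the misrouted copies are gone. The maximum exists
        since processors are finite in number; arbitrary values of \<open>K\<close> elsewhere can
        only delay it.\<close>
      define k where "k = Max (insert i (range K))"
      have k: "k \<ge> i" "k \<ge> K r" for r by (simp_all add: k_def del: Max_insert)
      have "en j q d" if "j \<ge> k" for j
      proof -
        obtain q' g' where E': "E j q d = Some (Msg m q' c g')"
          using E[of j] k(1) \<open>j \<ge> k\<close> by (auto simp: holds_msg_def)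
        have j: "j \<ge> T" "j \<ge> i" using i k(1) that by auto
        then have hop: "hop A (cfg j) q d = p" using hop_stable True by simp
        have 1: "holds_msg (R j (hop A (cfg j) q d) d) m q c"
          using hop R j by (simp add: holds_msg_def)
        have 2: "\<forall>r\<in>nbrs adj q - {hop A (cfg j) q d}. \<not> holds_msg (R j r d) m q c"
          using hop K k(2) that by (meson order_trans)
        show ?thesis
          by (rule enI[OF j(1) forward_move.R4[where C = "cfg j", OF E' \<open>q \<noteq> d\<close> 1 2]])
      qed
      moreover have "E j q d \<noteq> None" if "j \<ge> k" for j
        using E[of j] k(1) that by (auto simp: holds_msg_def)
      ultimately show False using E_stuck_not_enabled[of k q d] i k(1) by simp
    qed
  qed
  then obtain k where k: "k \<ge> i" "\<And>q'. \<not> holds_msg (E k q d) m q' c" by blast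
  have "\<forall>q'. \<not> holds_msg (E j q d) m q' c" if "j \<ge> k" for j
    using that
  proof (induction rule: dec_induct)
    case (step l)
    show ?case
    proof (intro allI notI)
      fix q' assume "holds_msg (E (Suc l) q d) m q' c"
      then obtain g' where "E (Suc l) q d = Some (Msg m q' c g')" by (auto simp: holds_msg_def)
      moreover from this have "E l q d \<noteq> Some (Msg m q' c g')"
        using step by (auto simp: holds_msg_def)
      ultimately show False
        by (rule E_new) (use R[of l] p step k(1) in \<open>auto simp: free_colors_def\<close>)
    qed
  qed (use k in blast)
  then show ?thesis using k(1) by blast
qed

text \<open>For a stuck message the sender guard of R2 holds from some time on. Once
  \<open>bufE\<close> is empty it stays so, since filling it would empty \<open>bufR\<close>; thus
  R2 is enabled forever.\<close>

lemma R_drains_if_E_drains: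
  assumes "E_drains p d"
  shows "R_drains p d"
  unfolding R_drains_def
proof (intro allI impI, rule ccontr)
  fix i x assume i: "i \<ge> T" and nd: "\<not> (\<exists>j\<ge>i. R j p d \<noteq> Some x)"
  obtain m q c g where x: "x = Msg m q c g" by (cases x)
  have R: "R j p d = Some (Msg m q c g)" if "j \<ge> i" for j using that nd x by blast
  obtain k where k: "k \<ge> i" "\<And>j. j \<ge> k \<Longrightarrow> q = p \<or> (\<forall>q'. \<not> holds_msg (E j q d) m q' c)"
    using sender_releases[OF i R] i by (cases "q = p") blast+
  \<comment> \<open>Draining only promises a different content, but the step at which
    \<open>y\<close> leaves is R4 or R6, and both empty the buffer.\<close>
  have "\<exists>l\<ge>k. E l p d = None"
  proof (rule ccontr)
    assume ne: "\<not> ?thesis"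
    then obtain y where y: "E k p d = Some y" by fastforce
    then obtain j where "j \<ge> k" "E j p d \<noteq> Some y"
      using assms i k(1) unfolding E_drains_def by (meson order_trans)
    then obtain l where l: "l \<ge> k" "E l p d = Some y" "E (Suc l) p d \<noteq> Some y"
      using eventually_leaves[of "\<lambda>j. E j p d = Some y" k j] y by blast
    then have "E (Suc l) p d = None"
      by (cases rule: E_left[OF l(2,3)]) (auto elim: R4_step R6_step)
    then show False using ne l(1) le_SucI by blast
  qed
  then obtain l where l: "l \<ge> k" "E l p d = None" by blast
  have E: "E j p d = None" if "j \<ge> l" for j
    using that
  proof (induction rule: dec_induct)
    case (step j)
    show ?case
    proof (rule ccontr)
      assume "E (Suc j) p d \<noteq> None"
      then obtain y where "E (Suc j) p d = Some y" "E j p d \<noteq> Some y" using step by auto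
      then show False by (rule E_new) (use R[of "Suc j"] step l(1) k(1) in auto)
    qed
  qed (rule l)
  have "en j p d" if "j \<ge> l" for j
  proof -
    obtain c' where c': "c' \<in> free_colors adj (cfg j) p d" using free_color_exists by blast
    have j: "j \<ge> T" "j \<ge> i" "j \<ge> k" using that l(1) k(1) i by auto
    show ?thesis
      by (rule enI[OF j(1) forward_move.R2[where C = "cfg j", OF E[OF that] R[OF j(2)] k(2)[OF j(3)] c']])
  qed
  moreover have "R j p d \<noteq> None" if "j \<ge> l" for j using R[of j] that l(1) k(1) by simp
  ultimately show False using R_stuck_not_enabled by blast
qed

text \<open>\<open>fair_choice\<close> helps only if R1 or R3 is executed infinitely often.
  Otherwise \<open>bufR\<close> would drain and stay empty while some candidate is chosen, so the
  instance would be enabled forever and have to execute R2 or R5 on an empty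
  \<open>bufR\<close>.\<close>

lemma permanent_candidate_served:
  assumes R: "R_drains p d" and i: "i \<ge> T"
    and cand: "\<And>j. j \<ge> i \<Longrightarrow> candidate adj A (cfg j) p d s"
  obtains j where "j \<ge> i" "act j p \<in> {Some (Forward d R1), Some (Forward d R3)}"
    "ch j p d = Some s"
proof -
  let ?A = "{Some (Forward d R1), Some (Forward d R3)}"
  have "\<exists>j\<ge>k. act j p \<in> ?A" for k
  proof (rule ccontr)
    assume "\<not> ?thesis"
    then have no: "act j p \<notin> ?A" if "j \<ge> k" for j using that by blast
    let ?k = "max i k"
    have "\<exists>l\<ge>?k. R l p d = None"
    proof (rule ccontr)
      assume ne: "\<not> ?thesis"
      then obtain y where y: "R ?k p d = Some y" by fastforce
      moreover have "?k \<ge> T" using i by simp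
      ultimately obtain j where "j \<ge> ?k" "R j p d \<noteq> Some y"
        using R unfolding R_drains_def by blast
      then obtain l where l: "l \<ge> ?k" "R l p d = Some y" "R (Suc l) p d \<noteq> Some y"
        using eventually_leaves[of "\<lambda>j. R j p d = Some y" ?k j] y by blast
      then have "R (Suc l) p d = None"
        by (cases rule: R_left[OF l(2,3)]) (auto elim: R2_step R5_step)
      then show False using ne l(1) le_SucI by blast
    qed
    then obtain l where l: "l \<ge> ?k" "R l p d = None" by blast
    have None: "R j p d = None" if "j \<ge> l" for j
      using that
    proof (induction rule: dec_induct)
      case (step j)
      show ?case
      proof (rule ccontr)
        assume "R (Suc j) p d \<noteq> None"
        then obtain y where "R (Suc j) p d = Some y" "R j p d \<noteq> Some y" using step by auto
        then show False by (cases rule: R_new) (use no[of j] step l(1) in auto)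
      qed
    qed (rule l)
    have "en j p d" if j: "j \<ge> l" for j
    proof -
      have T: "j \<ge> T" "j \<ge> i" using i j l(1) by auto
      then obtain s' where s': "ch j p d = Some s'"
        using fair_choice cand unfolding fair_choice_def by blast
      show ?thesis
      proof (cases "s' = p")
        case True
        then obtain m where "request (cfg j p)" "waiting (cfg j p) = Some (m, d)"
          using choice_candidate[OF s'] nbrs_irrefl by (auto simp: candidate_def)
        then show ?thesis using enI[OF T(1) forward_move.R1] None[OF j] s' True by blast
      next
        case False
        then obtain m q c g where "E j s' d = Some (Msg m q c g)"
          using candidate_nbr(2)[OF s'] by (metis message.exhaust not_None_eq)
        then show ?thesis using enI[OF T(1) forward_move.R3] None[OF j] s' False by blast
      qed
    qed
    then obtain j \<rho> where j: "j \<ge> l" "act j p = Some (Forward d \<rho>)" "\<rho> \<in> {R1, R2, R3, R5}"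
      using R_rule_executed by blast
    then have "act j p = Some (Forward d R2) \<or> act j p = Some (Forward d R5)"
      using no[of j] l(1) by auto
    then show False using None[OF j(1)] by (auto elim: R2_step R5_step)
  qed
  then show thesis using fair_choice cand that unfolding fair_choice_def by blast
qed

lemma E_drains_if_next_R_drains:
  assumes R: "R_drains (h d p) d" and p: "p \<noteq> d"
  shows "E_drains p d"
  unfolding E_drains_def
proof (intro allI impI, rule ccontr)
  fix i x assume i: "i \<ge> T" and nd: "\<not> (\<exists>j\<ge>i. E j p d \<noteq> Some x)"
  let ?r = "h d p"
  obtain m q c g where x: "x = Msg m q c g" by (cases x)
  have E: "E j p d = Some (Msg m q c g)" if "j \<ge> i" for j using that nd x by blast
  have pr: "p \<in> nbrs adj ?r" using h_nbr[OF p] nbrs_sym by blast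
  then have ne: "p \<noteq> ?r" using nbrs_irrefl by metis
  have "candidate adj A (cfg j) ?r d p" if "j \<ge> i" for j
    using pr E[OF that] hop_stable[of j p d] i that by (simp add: candidate_def)
  then obtain j where j: "j \<ge> i" "act j ?r \<in> {Some (Forward d R1), Some (Forward d R3)}"
    "ch j ?r d = Some p"
    using permanent_candidate_served[OF R i] by blast
  have y: "R (Suc j) ?r d = Some (Msg m p c g)"
  proof (cases "act j ?r = Some (Forward d R1)")
    case True
    then show ?thesis by (rule R1_step) (use j(3) ne in simp)
  next
    case False
    then have "act j ?r = Some (Forward d R3)" using j(2) by simp
    then show ?thesis by (rule R3_step) (use j(3) E[OF j(1)] in simp)
  qed
  moreover have "Suc j \<ge> T" using i j(1) by simp
  ultimately obtain k where "k \<ge> Suc j" "R k ?r d \<noteq> Some (Msg m p c g)"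
    using R unfolding R_drains_def by blast
  then obtain l where l: "l \<ge> Suc j" "R l ?r d = Some (Msg m p c g)"
    "R (Suc l) ?r d \<noteq> Some (Msg m p c g)"
    using eventually_leaves[of "\<lambda>j. R j ?r d = Some (Msg m p c g)" "Suc j" k] y by blast
  have l': "l \<ge> i" "l \<ge> T" using l(1) j(1) i by auto
  \<comment> \<open>The copy cannot leave: R2 is blocked while \<open>bufE\<close> of
    \<open>p\<close> matches it, and R5 requires a next hop other than \<open>?r\<close>.\<close>
  from l(2,3) show False
  proof (cases rule: R_left)
    case R2
    then show False by (rule R2_step) (use l(2) ne E[OF l'(1)] in \<open>auto simp: holds_msg_def\<close>)
  next
    case R5
    then show False by (rule R5_step) (use l(2) hop_stable[OF l'(2)] in auto)
  qed
qed

lemma E_drains: "E_drains p d"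
proof -
  have "E_drains p d" if "(h d ^^ k) p = d" for k p
    using that
  proof (induction k arbitrary: p)
    case 0
    then show ?case using E_drains_destination by simp
  next
    case (Suc k)
    show ?case
    proof (cases "p = d")
      case False
      have "E_drains (h d p) d" using Suc by (simp add: funpow_swap1)
      then show ?thesis using E_drains_if_next_R_drains R_drains_if_E_drains False by blast
    qed (use E_drains_destination in simp)
  qed
  then show ?thesis using reaches by blast
qed

lemma R_drains: "R_drains p d"
  using E_drains R_drains_if_E_drains by blast

section \<open>The specification\<close>

text \<open>Only R1 consumes the waiting message, and its guard ties the destination of the instance
  to that of the message.\<close>

lemma waiting_persists:
  assumes "waiting (cfg i p) = Some (m, d)" "\<not> generates cfg act i p m d"
  shows "waiting (cfg (Suc i) p) = Some (m, d)" "request (cfg i p) \<Longrightarrow> request (cfg (Suc i) p)"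
proof -
  obtain s where s: "local_step adj A i (cfg i) (ch i) p (act i p) s"
    "higher_layer s (cfg (Suc i) p)" using step by blast
  have "waiting s = Some (m, d) \<and> request s = request (cfg i p)"
  proof (cases "act i p")
    case None
    then show ?thesis using s assms by simp
  next
    case (Some a)
    show ?thesis
    proof (cases a)
      case Route
      then show ?thesis using s assms Some by auto
    next
      case (Forward d' \<rho>)
      then have "forward_move adj A i (cfg i) (ch i) p d' \<rho> s" using s Some by simp
      then show ?thesis
        by cases (use assms Some Forward in \<open>auto simp: generates_def\<close>)
    qed
  qed
  then show "waiting (cfg (Suc i) p) = Some (m, d)" "request (cfg i p) \<Longrightarrow> request (cfg (Suc i) p)"
    using s(2) by (auto simp: higher_layer_def)
qed

lemma generation: "generation_in_finite_time cfg act"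
  unfolding generation_in_finite_time_def
proof (intro allI impI, rule ccontr, elim conjE exE)
  fix i p m d k
  assume w: "waiting (cfg i p) = Some (m, d)" and k: "k \<ge> i" "request (cfg k p)"
    and "\<not> (\<exists>j\<ge>i. generates cfg act j p m d)"
  then have no: "\<not> generates cfg act j p m d" if "j \<ge> i" for j using that by blast
  have w': "waiting (cfg j p) = Some (m, d)" if "j \<ge> i" for j
    using that
  proof (induction rule: dec_induct)
    case (step j)
    then show ?case using waiting_persists(1) no by blast
  qed (rule w)
  have r: "request (cfg j p)" if "j \<ge> k" for j
    using that
  proof (induction rule: dec_induct)
    case (step j)
    then show ?case using waiting_persists(2)[OF w' no] k(1) by simp
  qed (rule k)
  let ?l = "max k T"
  have "candidate adj A (cfg j) p d p" if "j \<ge> ?l" for j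
    using w'[of j] r[of j] that k(1) by (simp add: candidate_def)
  then obtain j where j: "j \<ge> ?l" "act j p \<in> {Some (Forward d R1), Some (Forward d R3)}"
    "ch j p d = Some p"
    using permanent_candidate_served[OF R_drains, of ?l p d p] by auto
  have "act j p \<noteq> Some (Forward d R3)"
  proof
    assume "act j p = Some (Forward d R3)"
    then show False by (rule R3_step) (use j(3) in simp)
  qed
  then have "generates cfg act j p m d"
    using j(1,2) w'[of j] k(1) by (simp add: generates_def)
  then show False using no[of j] j(1) k(1) by simp
qed

text \<open>Induction on the number of hops: R4 hands the message over to \<open>bufR\<close> of the
  next hop, from where only R2 can move it, since its sender is correctly routed there.\<close>

lemma E_delivered:
  assumes "i \<ge> T" "holds_ident (E i p d) g"
  shows "\<exists>j m. delivers cfg act j d m g"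
proof -
  obtain k where "(h d ^^ k) p = d" using reaches by blast
  then show ?thesis
    using assms
  proof (induction k arbitrary: p i)
    case (0 p i)
    then obtain x where x: "E i d d = Some x" "ident x = g" by (auto simp: holds_ident_def)
    then obtain j where "j \<ge> i" "E j d d \<noteq> Some x"
      using E_drains[of d d] 0(2) unfolding E_drains_def by blast
    then obtain l where l: "l \<ge> i" "E l d d = Some x" "E (Suc l) d d \<noteq> Some x"
      using eventually_leaves[of "\<lambda>j. E j d d = Some x" i j] x by blast
    from l(2,3) have "act l d = Some (Forward d R6)"
    proof (cases rule: E_left)
      case R4
      then show ?thesis by (rule R4_step) simp
    qed
    then have "delivers cfg act l d (info x) g"
      using l(2) x(2) by (cases x) (simp add: delivers_def)
    then show ?case by blast
  next
    case (Suc k p i)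
    show ?case
    proof (cases "p = d")
      case True
      \<comment> \<open>\<open>d\<close> is a fixed point of \<open>h d\<close>, so
        \<open>Suc k\<close> need not be the least number of hops.\<close>
      then have "(h d ^^ k) p = d" by (induction k) (simp_all add: h_self)
      then show ?thesis using Suc by blast
    next
      case False
      let ?r = "h d p"
      obtain x where x: "E i p d = Some x" "ident x = g"
        using Suc.prems by (auto simp: holds_ident_def)
      then obtain j where "j \<ge> i" "E j p d \<noteq> Some x"
        using E_drains[of p d] Suc.prems(2) unfolding E_drains_def by blast
      then obtain l where l: "l \<ge> i" "E l p d = Some x" "E (Suc l) p d \<noteq> Some x"
        using eventually_leaves[of "\<lambda>j. E j p d = Some x" i j] x by blast
      have "l \<ge> T" using l(1) Suc.prems(2) by simp
      from l(2,3) have "act l p = Some (Forward d R4)"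
      proof (cases rule: E_left)
        case R6
        then show ?thesis by (rule R6_step) (use False in simp)
      qed
      then obtain y where y: "R (Suc l) ?r d = Some y" "sender y = p" "ident y = g"
        using R4_hands_over[OF _ l(2)] hop_stable[OF \<open>l \<ge> T\<close>] x(2) by metis
      moreover have "Suc l \<ge> T" using \<open>l \<ge> T\<close> by simp
      ultimately obtain j where "j \<ge> Suc l" "R j ?r d \<noteq> Some y"
        using R_drains[of ?r d] unfolding R_drains_def by blast
      then obtain l' where l': "l' \<ge> Suc l" "R l' ?r d = Some y" "R (Suc l') ?r d \<noteq> Some y"
        using eventually_leaves[of "\<lambda>j. R j ?r d = Some y" "Suc l" j] y by blast
      have "l' \<ge> T" using l'(1) \<open>l \<ge> T\<close> by simp
      then have "holds_ident (E (Suc l') ?r d) g"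
        using R_left_copy[OF l'(2,3)] hop_stable[of l' p d] y by (auto simp: holds_ident_def)
      moreover have "(h d ^^ k) ?r = d" using Suc.prems(1) by (simp add: funpow_swap1)
      ultimately show ?thesis using Suc.IH[of ?r "Suc l'"] \<open>l' \<ge> T\<close> by simp
    qed
  qed
qed

text \<open>When a \<open>bufR\<close> copy leaves, either R2 has put it into \<open>bufE\<close> or
  R5 has seen a copy in that of its sender.\<close>

lemma present_delivered:
  assumes "i \<ge> T" "present i d g"
  shows "\<exists>j m. delivers cfg act j d m g"
proof (cases "\<exists>p. holds_ident (E i p d) g")
  case True
  then show ?thesis using E_delivered assms(1) by blast
next
  case False
  then obtain r y where y: "R i r d = Some y" "ident y = g"
    using assms(2) by (auto simp: present_def holds_ident_def)
  then obtain j where "j \<ge> i" "R j r d \<noteq> Some y"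
    using R_drains[of r d] assms(1) unfolding R_drains_def by blast
  then obtain l where l: "l \<ge> i" "R l r d = Some y" "R (Suc l) r d \<noteq> Some y"
    using eventually_leaves[of "\<lambda>j. R j r d = Some y" i j] y by blast
  then have "\<exists>p. holds_ident (E (Suc l) p d) g \<or> holds_ident (E l p d) g"
    using R_left_copy[OF l(2,3)] y(2) by (auto simp: holds_ident_def)
  moreover have "l \<ge> T" "Suc l \<ge> T" using l(1) assms(1) by auto
  ultimately show ?thesis using E_delivered by blast
qed

lemma delivery: "delivery_exactly_once cfg act"
  unfolding delivery_exactly_once_def
proof (intro allI impI)
  fix i p m d assume gen: "generates cfg act i p m d"
  let ?g = "Generated i p"
  have "\<exists>j m'. delivers cfg act j d m' ?g"
  \<comment> \<open>The first time at which the message has been generated and the tables are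
    stable. If it is absent by then, it has been delivered already, possibly under incorrect
    tables.\<close>
  proof (cases "present (max (Suc i) T) d ?g")
    case True
    show ?thesis by (rule present_delivered[OF _ True]) simp
  next
    case False
    moreover have "i < max (Suc i) T" by simp
    ultimately show ?thesis using present_until_delivered[OF gen] by blast
  qed
  then obtain j m' where "delivers cfg act j d m' ?g" by blast
  with delivers_unique[OF gen this] have j: "delivers cfg act j d m ?g" by simp
  have uniq: "(j', q, m') = (j, d, m)" if "delivers cfg act j' q m' ?g" for j' q m'
    using that delivers_unique[OF gen that] delivers_once[OF j] by simp
  have "{(j', q, m'). delivers cfg act j' q m' ?g} = {(j, d, m)}"
  proof (intro equalityI subsetI)
    fix z assume z: "z \<in> {(j', q, m'). delivers cfg act j' q m' ?g}"
    obtain j' q m' where "z = (j', q, m')" by (rule prod_cases3)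
    then show "z \<in> {(j, d, m)}" using uniq[of j' q m'] z by simp
  qed (use j in simp)
  moreover have "j > i" using delivers_unique[OF gen j] by simp
  ultimately show "\<exists>j>i. {(j', q, m'). delivers cfg act j' q m' ?g} = {(j, d, m)}"
    by (intro exI conjI)
qed

end

theorem theorem1:
  fixes adj :: "'v::finite \<Rightarrow> 'v \<Rightarrow> bool"
    and A :: "('v, 'r) routing"
    and cfg :: "nat \<Rightarrow> ('v, 'm, 'r) config"
    and act :: "nat \<Rightarrow> 'v \<Rightarrow> 'v action option"
    and ch :: "nat \<Rightarrow> 'v \<Rightarrow> 'v \<Rightarrow> 'v option"
  assumes "network adj"
    and "routing_algorithm adj A"
    and "silent_self_stabilizing adj A"
    and "initial_configuration adj (cfg 0)"
    and "execution adj A cfg act ch"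
    and "fair_choice adj A cfg act ch"
    and "weakly_fair adj A cfg act ch"
  shows "specification_SP cfg act"
proof -
  interpret ssmfp_execution adj A cfg act ch
    using assms by unfold_locales
  obtain T h where "\<And>i p. i \<ge> T \<Longrightarrow> \<not> routing_enabled A (cfg i) p"
    "\<And>i p d. i \<ge> T \<Longrightarrow> hop A (cfg i) p d = h d p" "\<And>p d. \<exists>k. (h d ^^ k) p = d"
    using tables_stabilize by blast
  then interpret stable_execution adj A cfg act ch T h
    by unfold_locales
  show ?thesis
    unfolding specification_SP_def using generation delivery by blast
qed

end
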